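(* Let $\{\mu_t\}_{t\ge0}$ be a weakly continuous $\rhd$-convolution semigroup with $\mu_0=\delta_0$ and associated pair $(\gamma,\tau)$, and let $n\ge1$ be an integer. The following are equivalent: (1) there exists $t_0>0$ such that $\int_{\mathbb{R}}x^{2n}\mu_{t_0}(dx)<\infty$; (2) $\int_{\mathbb{R}}x^{2n}\mu_t(dx)<\infty$ for all $0<t<\infty$; (3) $\int_{\mathbb{R}}x^{2n}\tau(dx)<\infty$.
   Context: For a probability measure $\mu$, $G_\mu(z)=\int\frac{1}{z-x}d\mu(x)$ on $\mathbb{C}^+$ and $H_\mu=1/G_\mu$; $\mu\rhd\nu$ is the unique probability measure with $H_{\mu\rhd\nu}=H_\mu\circ H_\nu$. A weakly continuous $\rhd$-convolution semigroup is a weakly continuous family $\{\mu_t\}_{t\ge0}$ of probability measures with $\mu_s\rhd\mu_t=\mu_{s+t}$. For such a semigroup with $\mu_0=\delta_0$ there is a unique pair $(\gamma,\tau)$, $\gamma\in\mathbb{R}$, $\tau$ positive finite, such that with $A(z)=-\gamma+\int\frac{1+xz}{x-z}d\tau(x)$ the maps $H_t:=H_{\mu_t}$ solve $\frac{d}{dt}H_t(z)=A(H_t(z))$, $H_0(z)=z$, on $\mathbb{C}\setminus\mathbb{R}$ (the associated pair). *)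

theory Defs
  imports "HOL-Probability.Probability"
begin

definition is_prob_real :: "real measure \<Rightarrow> bool" where
  "is_prob_real \<mu> \<longleftrightarrow> prob_space \<mu> \<and> sets \<mu> = sets borel"

definition cauchy_G :: "real measure \<Rightarrow> complex \<Rightarrow> complex" where
  "cauchy_G \<mu> z = (\<integral>x. 1 / (z - complex_of_real x) \<partial>\<mu>)"

definition recip_H :: "real measure \<Rightarrow> complex \<Rightarrow> complex" where
  "recip_H \<mu> z = 1 / cauchy_G \<mu> z"

definition mono_conv :: "real measure \<Rightarrow> real measure \<Rightarrow> real measure" where
  "mono_conv \<mu> \<nu> = (THE \<rho>. is_prob_real \<rho> \<and>
      (\<forall>z. Im z > 0 \<longrightarrow> recip_H \<rho> z = recip_H \<mu> (recip_H \<nu> z)))"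

definition weakly_continuous_family :: "(real \<Rightarrow> real measure) \<Rightarrow> bool" where
  "weakly_continuous_family \<mu> \<longleftrightarrow>
     (\<forall>f :: real \<Rightarrow> real. continuous_on UNIV f \<and> bounded (range f) \<longrightarrow>
        continuous_on {0..} (\<lambda>t. \<integral>x. f x \<partial>(\<mu> t)))"

definition mono_conv_semigroup :: "(real \<Rightarrow> real measure) \<Rightarrow> bool" where
  "mono_conv_semigroup \<mu> \<longleftrightarrow>
     (\<forall>t\<ge>0. is_prob_real (\<mu> t)) \<and> weakly_continuous_family \<mu> \<and>
     (\<forall>s\<ge>0. \<forall>t\<ge>0. mono_conv (\<mu> s) (\<mu> t) = \<mu> (s + t))"

definition gen_A :: "real \<Rightarrow> real measure \<Rightarrow> complex \<Rightarrow> complex" where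
  "gen_A \<gamma> \<tau> z = - complex_of_real \<gamma> +
      (\<integral>x. (1 + complex_of_real x * z) / (complex_of_real x - z) \<partial>\<tau>)"

definition assoc_pair :: "(real \<Rightarrow> real measure) \<Rightarrow> real \<Rightarrow> real measure \<Rightarrow> bool" where
  "assoc_pair \<mu> \<gamma> \<tau> \<longleftrightarrow>
     finite_measure \<tau> \<and> sets \<tau> = sets borel \<and>
     (\<forall>z. Im z \<noteq> 0 \<longrightarrow>
        recip_H (\<mu> 0) z = z \<and>
        (\<forall>t\<ge>0. ((\<lambda>s. recip_H (\<mu> s) z) has_vector_derivative
                   gen_A \<gamma> \<tau> (recip_H (\<mu> t) z)) (at t within {0..})))"

end

theory Submission
  imports Defs "HOL-Computational_Algebra.Polynomial"
begin

text \<open>A measure has a finite moment of order \<open>2 n\<close> iff its Cauchy transform at \<open>\<i> y\<close> has an asymptotic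
  expansion to the corresponding order in \<open>u = 1 / (\<i> y)\<close> with real coefficients. For \<open>\<mu>\<^sub>t\<close> this is an
  expansion of \<open>H\<^sub>t(\<i> y) - \<i> y\<close> with error \<open>O(u\<^bsup>2n-1\<^esup>)\<close>, and for \<open>\<tau>\<close> one of \<open>A(\<i> y)\<close> with the same error.

  From \<open>A\<close> to \<open>H\<^sub>t\<close>: substitute the known part of the expansion into the integrated differential equation and
  gain one order at a time.

  From \<open>H\<^sub>t\<close> to \<open>A\<close>: the case \<open>n = 1\<close> follows from the positivity of \<open>Im A\<close>. If \<open>\<tau>\<close> has the moment of order
  \<open>2 k\<close>, then \<open>A(w) = P(1/w) + w\<^bsup>1-2k\<^esup> K(w)\<close> up to a negligible term, where \<open>P\<close> is a real polynomial and \<open>K(w)\<close> is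
  the integral of \<open>x / (x - w)\<close> against \<open>x\<^bsup>2k\<^esup> d\<tau>\<close>. As inversion gains two orders, \<open>P(1/H\<^sub>s)\<close> is already known to
  the order needed, so \<open>K(\<i> y)\<close> is known as well; its real part, the integral of \<open>x\<^sup>2 / (x\<^sup>2 + y\<^sup>2)\<close>, is then
  \<open>O(y\<^bsup>-2\<^esup>)\<close>, and Fatou's lemma gives the moment of order \<open>2 k + 2\<close>.\<close>

section \<open>Real expansions in powers of \<open>1 / (\<i> y)\<close>\<close>

text \<open>Expanding in 1 / (\<i> y) instead of 1 / y makes the coefficients real: they are moments
  up to sign.\<close>

definition iu :: "real \<Rightarrow> complex" where
  "iu y = 1 / (\<i> * complex_of_real y)"

lemma norm_iu: "y > 0 \<Longrightarrow> norm (iu y) = 1 / y"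
  by (simp add: iu_def norm_divide norm_mult)

lemma iu_mult_iy: "y \<noteq> 0 \<Longrightarrow> iu y * (\<i> * complex_of_real y) = 1"
  by (simp add: iu_def)

lemma tendsto_iu: "(iu \<longlongrightarrow> 0) at_top"
proof (rule tendsto_norm_zero_cancel)
  have "((\<lambda>y::real. 1 / y) \<longlongrightarrow> 0) at_top" by real_asymp
  moreover have "\<forall>\<^sub>F y in at_top. 1 / y = norm (iu y)"
    using eventually_gt_at_top[of 0] by eventually_elim (simp add: norm_iu)
  ultimately show "((\<lambda>y. norm (iu y)) \<longlongrightarrow> 0) at_top"
    by (rule Lim_transform_eventually)
qed

section \<open>Real polynomials and continuous families of them\<close>

definition real_poly :: "complex poly \<Rightarrow> bool" where
  "real_poly p \<longleftrightarrow> (\<forall>j. coeff p j \<in> \<real>)"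

lemma real_poly_pCons [simp]: "real_poly (pCons a p) \<longleftrightarrow> a \<in> \<real> \<and> real_poly p"
  unfolding real_poly_def
  by (auto simp: coeff_pCons split: nat.splits)

lemma real_poly_0 [simp]: "real_poly 0"
  by (simp add: real_poly_def)

lemma real_poly_add: "real_poly p \<Longrightarrow> real_poly q \<Longrightarrow> real_poly (p + q)"
  by (simp add: real_poly_def)

lemma real_poly_diff: "real_poly p \<Longrightarrow> real_poly q \<Longrightarrow> real_poly (p - q)"
  by (simp add: real_poly_def)

lemma real_poly_mult: "real_poly p \<Longrightarrow> real_poly q \<Longrightarrow> real_poly (p * q)"
  by (simp add: real_poly_def coeff_mult)

lemma poly_eq_sum_atMost:
  fixes p :: "'a::comm_semiring_1 poly"
  assumes "degree p \<le> M"
  shows "poly p x = (\<Sum>j\<le>M. coeff p j * x ^ j)"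
  using arg_cong[OF poly_as_sum_of_monoms'[OF assms], of "\<lambda>p. poly p x"]
  by (simp add: poly_sum poly_monom)

text \<open>Continuity in time allows the coefficients to be integrated along the flow. The common
  degree bound turns all polynomials into sums over one index range, so that estimates on a compact
  \<open>S\<close> are uniform.\<close>

definition poly_path :: "real set \<Rightarrow> (real \<Rightarrow> complex poly) \<Rightarrow> bool" where
  "poly_path S p \<longleftrightarrow> (\<forall>s\<in>S. real_poly (p s)) \<and> (\<exists>M. \<forall>s\<in>S. degree (p s) \<le> M) \<and>
     (\<forall>j. continuous_on S (\<lambda>s. coeff (p s) j))"

lemma poly_path_const: "real_poly q \<Longrightarrow> poly_path S (\<lambda>s. q)"
  by (auto simp: poly_path_def)

lemma poly_path_add:
  assumes "poly_path S p" "poly_path S q"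
  shows "poly_path S (\<lambda>s. p s + q s)"
proof -
  obtain M N where "\<forall>s\<in>S. degree (p s) \<le> M" "\<forall>s\<in>S. degree (q s) \<le> N"
    using assms by (auto simp: poly_path_def)
  then have "\<forall>s\<in>S. degree (p s + q s) \<le> max M N"
    by (meson degree_add_le le_max_iff_disj)
  then show ?thesis using assms
    by (auto simp: poly_path_def intro!: real_poly_add continuous_intros)
qed

lemma poly_path_mult:
  assumes "poly_path S p" "poly_path S q"
  shows "poly_path S (\<lambda>s. p s * q s)"
proof -
  obtain M N where "\<forall>s\<in>S. degree (p s) \<le> M" "\<forall>s\<in>S. degree (q s) \<le> N"
    using assms by (auto simp: poly_path_def)
  then have "\<forall>s\<in>S. degree (p s * q s) \<le> M + N"
    by (meson add_mono degree_mult_le order_trans)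
  then show ?thesis using assms
    by (auto simp: poly_path_def coeff_mult intro!: real_poly_mult continuous_intros)
qed

lemma poly_path_bounded:
  assumes "poly_path S p" "compact S"
  obtains B where "B \<ge> 0" "\<And>s v. s \<in> S \<Longrightarrow> norm v \<le> 1 \<Longrightarrow> norm (poly (p s) v) \<le> B"
proof -
  obtain M where M: "\<forall>s\<in>S. degree (p s) \<le> M" using assms by (auto simp: poly_path_def)
  have "\<exists>b. \<forall>s\<in>S. norm (coeff (p s) j) \<le> b" for j
  proof -
    have "compact ((\<lambda>s. coeff (p s) j) ` S)"
      using assms by (intro compact_continuous_image) (auto simp: poly_path_def)
    then show ?thesis by (meson bounded_iff compact_imp_bounded imageI)
  qed
  then obtain b where b: "\<And>j s. s \<in> S \<Longrightarrow> norm (coeff (p s) j) \<le> b j" by metis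
  have "norm (poly (p s) v) \<le> (\<Sum>j\<le>M. \<bar>b j\<bar>)" if "s \<in> S" "norm v \<le> 1" for s v
  proof -
    have "poly (p s) v = (\<Sum>j\<le>M. coeff (p s) j * v ^ j)"
      using M that by (simp add: poly_eq_sum_atMost)
    also have "norm \<dots> \<le> (\<Sum>j\<le>M. \<bar>b j\<bar>)"
    proof (rule sum_norm_le)
      fix j
      have "norm (coeff (p s) j) * norm v ^ j \<le> \<bar>b j\<bar> * 1"
        using b[OF that(1), of j] that(2) by (intro mult_mono) (auto simp: power_le_one)
      then show "norm (coeff (p s) j * v ^ j) \<le> \<bar>b j\<bar>" by (simp add: norm_mult norm_power)
    qed
    finally show ?thesis .
  qed
  then show ?thesis using that[of "\<Sum>j\<le>M. \<bar>b j\<bar>"] by (auto simp: sum_nonneg)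
qed

text \<open>The error is uniform in \<open>s\<close>. The coefficients are required to be real because this is what
  separates them from the first divergent moment.\<close>
definition expands :: "real set \<Rightarrow> nat \<Rightarrow> (real \<Rightarrow> real \<Rightarrow> complex) \<Rightarrow> bool" where
  "expands S K f \<longleftrightarrow> (\<exists>p C. poly_path S p \<and>
     (\<forall>s\<in>S. \<forall>y\<ge>1. norm (f s y - poly (p s) (iu y)) \<le> C / y ^ K))"

lemma expandsI:
  assumes "poly_path S p" "\<And>s y. s \<in> S \<Longrightarrow> y \<ge> 1 \<Longrightarrow> norm (f s y - poly (p s) (iu y)) \<le> C / y ^ K"
  shows "expands S K f"
  using assms unfolding expands_def by blast

lemma expandsE:
  assumes "expands S K f"
  obtains p C where "poly_path S p" "C \<ge> 0"
    "\<And>s y. s \<in> S \<Longrightarrow> y \<ge> 1 \<Longrightarrow> norm (f s y - poly (p s) (iu y)) \<le> C / y ^ K"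
proof -
  obtain p C where p: "poly_path S p"
    "\<And>s y. s \<in> S \<Longrightarrow> y \<ge> 1 \<Longrightarrow> norm (f s y - poly (p s) (iu y)) \<le> C / y ^ K"
    using assms unfolding expands_def by blast
  have "norm (f s y - poly (p s) (iu y)) \<le> max 0 C / y ^ K" if "s \<in> S" "y \<ge> 1" for s y
    by (rule order_trans[OF p(2)[OF that]]) (use that in \<open>auto intro!: divide_right_mono\<close>)
  then show ?thesis using that[of p "max 0 C"] p(1) by auto
qed

lemma expands_subset: "expands S K f \<Longrightarrow> S' \<subseteq> S \<Longrightarrow> expands S' K f"
  unfolding expands_def poly_path_def by (blast intro: continuous_on_subset)

lemma expands_cong:
  assumes "expands S K f" "\<And>s y. s \<in> S \<Longrightarrow> y \<ge> 1 \<Longrightarrow> g s y = f s y"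
  shows "expands S K g"
  using assms by (simp add: expands_def)

lemma expands_mono:
  assumes "expands S K f" "L \<le> K"
  shows "expands S L f"
proof -
  obtain p C where p: "poly_path S p" "C \<ge> 0"
    "\<And>s y. s \<in> S \<Longrightarrow> y \<ge> 1 \<Longrightarrow> norm (f s y - poly (p s) (iu y)) \<le> C / y ^ K"
    using expandsE[OF assms(1)] by metis
  show ?thesis
  proof (rule expandsI[OF p(1)])
    fix s y :: real assume sy: "s \<in> S" "y \<ge> 1"
    have "C / y ^ K \<le> C / y ^ L"
      using sy p(2) assms(2) by (intro divide_left_mono) (auto intro: power_increasing)
    then show "norm (f s y - poly (p s) (iu y)) \<le> C / y ^ L" using p(3)[OF sy] by linarith
  qed
qed

lemma expands_small:
  assumes "\<And>s y. s \<in> S \<Longrightarrow> y \<ge> 1 \<Longrightarrow> norm (f s y) \<le> C / y ^ K"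
  shows "expands S K f"
  by (rule expandsI[OF poly_path_const[of 0], where C = C]) (use assms in auto)

lemma expands_poly: "real_poly q \<Longrightarrow> expands S K (\<lambda>s y. poly q (iu y))"
  by (rule expandsI[OF poly_path_const, of q _ _ 0]) auto

lemma expands_add:
  assumes "expands S K f" "expands S K g"
  shows "expands S K (\<lambda>s y. f s y + g s y)"
proof -
  obtain p C where p: "poly_path S p" "C \<ge> 0"
    "\<And>s y. s \<in> S \<Longrightarrow> y \<ge> 1 \<Longrightarrow> norm (f s y - poly (p s) (iu y)) \<le> C / y ^ K"
    using expandsE[OF assms(1)] by metis
  obtain q D where q: "poly_path S q" "D \<ge> 0"
    "\<And>s y. s \<in> S \<Longrightarrow> y \<ge> 1 \<Longrightarrow> norm (g s y - poly (q s) (iu y)) \<le> D / y ^ K"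
    using expandsE[OF assms(2)] by metis
  show ?thesis
  proof (rule expandsI[OF poly_path_add[OF p(1) q(1)]])
    fix s y :: real assume sy: "s \<in> S" "y \<ge> 1"
    have "norm ((f s y - poly (p s) (iu y)) + (g s y - poly (q s) (iu y))) \<le> C / y ^ K + D / y ^ K"
      using p(3)[OF sy] q(3)[OF sy] norm_triangle_le add_mono by blast
    then show "norm (f s y + g s y - poly (p s + q s) (iu y)) \<le> (C + D) / y ^ K"
      by (simp add: add_divide_distrib algebra_simps)
  qed
qed

text \<open>Compactness of \<open>S\<close> bounds both polynomials on the closed unit disc,
  uniformly in time, so each error term meets only a bounded factor.\<close>

lemma expands_mult:
  assumes "expands S K f" "expands S K g" "compact S"
  shows "expands S K (\<lambda>s y. f s y * g s y)"
proof -
  obtain p C where p: "poly_path S p" "C \<ge> 0"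
    "\<And>s y. s \<in> S \<Longrightarrow> y \<ge> 1 \<Longrightarrow> norm (f s y - poly (p s) (iu y)) \<le> C / y ^ K"
    using expandsE[OF assms(1)] by metis
  obtain q D where q: "poly_path S q" "D \<ge> 0"
    "\<And>s y. s \<in> S \<Longrightarrow> y \<ge> 1 \<Longrightarrow> norm (g s y - poly (q s) (iu y)) \<le> D / y ^ K"
    using expandsE[OF assms(2)] by metis
  obtain B where B: "B \<ge> 0" "\<And>s v. s \<in> S \<Longrightarrow> norm v \<le> 1 \<Longrightarrow> norm (poly (p s) v) \<le> B"
    using poly_path_bounded[OF p(1) assms(3)] by metis
  obtain B' where B': "B' \<ge> 0" "\<And>s v. s \<in> S \<Longrightarrow> norm v \<le> 1 \<Longrightarrow> norm (poly (q s) v) \<le> B'"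
    using poly_path_bounded[OF q(1) assms(3)] by metis
  show ?thesis
  proof (rule expandsI[OF poly_path_mult[OF p(1) q(1)]])
    fix s y :: real assume sy: "s \<in> S" "y \<ge> 1"
    define a where "a = poly (p s) (iu y)"
    define b where "b = poly (q s) (iu y)"
    have iu: "norm (iu y) \<le> 1" using sy by (simp add: norm_iu)
    have a: "norm a \<le> B" and b: "norm b \<le> B'"
      using B(2)[OF sy(1) iu] B'(2)[OF sy(1) iu] by (auto simp: a_def b_def)
    have fa: "norm (f s y - a) \<le> C / y ^ K" and gb: "norm (g s y - b) \<le> D / y ^ K"
      using p(3)[OF sy] q(3)[OF sy] by (auto simp: a_def b_def)
    have D: "D / y ^ K \<le> D" using sy q(2) by (simp add: divide_le_eq mult_le_cancel_left1)
    have g: "norm (g s y) \<le> D + B'"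
      using norm_triangle_sub[of "g s y" b] gb b D by linarith
    have "f s y * g s y - a * b = (f s y - a) * g s y + a * (g s y - b)"
      by (simp add: algebra_simps)
    also have "norm \<dots> \<le> C / y ^ K * (D + B') + B * (D / y ^ K)"
      unfolding norm_mult[symmetric]
      by (rule norm_triangle_le, rule add_mono)
        (use p(2) q(2) B(1) B'(1) sy in \<open>simp_all add: norm_mult mult_mono[OF fa g] mult_mono[OF a gb] del: times_divide_eq_left times_divide_eq_right\<close>)
    also have "\<dots> = (C * (D + B') + B * D) / y ^ K"
      unfolding add_divide_distrib by simp
    finally show "norm (f s y * g s y - poly (p s * q s) (iu y)) \<le> (C * (D + B') + B * D) / y ^ K"
      by (simp add: a_def b_def)
  qed
qed

lemma expands_minus: "expands S K f \<Longrightarrow> compact S \<Longrightarrow> expands S K (\<lambda>s y. - f s y)"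
  using expands_mult[OF expands_poly[of "[:-1:]"], of S K f] by simp

lemma expands_power: "expands S K f \<Longrightarrow> compact S \<Longrightarrow> expands S K (\<lambda>s y. f s y ^ m)"
proof (induction m)
  case 0
  show ?case using expands_poly[of "[:1:]"] by simp
next
  case (Suc m)
  then show ?case using expands_mult[of S K f "\<lambda>s y. f s y ^ m"] by simp
qed

lemma expands_sum:
  "finite A \<Longrightarrow> (\<And>j. j \<in> A \<Longrightarrow> expands S K (f j)) \<Longrightarrow> expands S K (\<lambda>s y. \<Sum>j\<in>A. f j s y)"
proof (induction rule: finite_induct)
  case empty
  show ?case using expands_poly[of 0] by simp
next
  case (insert x F)
  then show ?case using expands_add[of S K "f x"] by simp
qed

lemma expands_poly_comp:
  assumes "expands S K f" "compact S" "real_poly q"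
  shows "expands S K (\<lambda>s y. poly q (f s y))"
  using assms(3)
proof (induction q)
  case 0
  show ?case using expands_poly[of 0] by simp
next
  case (pCons a q)
  then have "a \<in> \<real>" and IH: "expands S K (\<lambda>s y. poly q (f s y))" by auto
  then show ?case
    using expands_add[OF expands_poly[of "[:a:]"] expands_mult[OF assms(1) IH assms(2)]] by simp
qed

lemma expands_iu_mult:
  assumes "expands S K f"
  shows "expands S (Suc K) (\<lambda>s y. iu y * f s y)"
proof -
  obtain p C where p: "poly_path S p" "C \<ge> 0"
    "\<And>s y. s \<in> S \<Longrightarrow> y \<ge> 1 \<Longrightarrow> norm (f s y - poly (p s) (iu y)) \<le> C / y ^ K"
    using expandsE[OF assms(1)] by metis
  have "poly_path S (\<lambda>s. [:0, 1:] * p s)"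
    by (rule poly_path_mult[OF poly_path_const p(1)]) auto
  then show ?thesis
  proof (rule expandsI)
    fix s y :: real assume sy: "s \<in> S" "y \<ge> 1"
    have "norm (iu y * f s y - poly ([:0, 1:] * p s) (iu y)) = norm (iu y) * norm (f s y - poly (p s) (iu y))"
      by (simp add: norm_mult[symmetric] algebra_simps)
    also have "\<dots> \<le> norm (iu y) * (C / y ^ K)"
      by (rule mult_left_mono[OF p(3)[OF sy]]) simp
    finally show "norm (iu y * f s y - poly ([:0, 1:] * p s) (iu y)) \<le> C / y ^ Suc K"
      using sy by (simp add: norm_iu)
  qed
qed

lemma expands_bounded:
  assumes "expands S K f" "compact S"
  obtains B where "B \<ge> 0" "\<And>s y. s \<in> S \<Longrightarrow> y \<ge> 1 \<Longrightarrow> norm (f s y) \<le> B"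
proof -
  obtain p C where p: "poly_path S p" "C \<ge> 0"
    "\<And>s y. s \<in> S \<Longrightarrow> y \<ge> 1 \<Longrightarrow> norm (f s y - poly (p s) (iu y)) \<le> C / y ^ K"
    using expandsE[OF assms(1)] by metis
  obtain B where B: "B \<ge> 0" "\<And>s v. s \<in> S \<Longrightarrow> norm v \<le> 1 \<Longrightarrow> norm (poly (p s) v) \<le> B"
    using poly_path_bounded[OF p(1) assms(2)] by metis
  have "norm (f s y) \<le> B + C" if sy: "s \<in> S" "y \<ge> 1" for s y
  proof -
    have "norm (iu y) \<le> 1" using sy by (simp add: norm_iu)
    moreover have "C / y ^ K \<le> C" using sy p(2) by (simp add: divide_le_eq mult_le_cancel_left1)
    ultimately show ?thesis
      using norm_triangle_sub[of "f s y" "poly (p s) (iu y)"] p(3)[OF sy] B(2)[OF sy(1)] by fastforce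
  qed
  then show ?thesis using that[of "B + C"] B(1) p(2) by auto
qed

text \<open>Finite geometric series in \<open>- iu y * g s y\<close>: the first \<open>Suc K\<close>
  terms have expansions by the product rules, and the remainder contains
  \<open>iu y ^ Suc K\<close>, a bounded power of \<open>g\<close>, and a denominator kept away from
  0 by \<open>c\<close>.\<close>

lemma expands_inverse:
  assumes "expands S K g" "compact S" "c > 0"
    and c: "\<And>s y. s \<in> S \<Longrightarrow> y \<ge> 1 \<Longrightarrow> c \<le> norm (1 + iu y * g s y)"
  shows "expands S (Suc K) (\<lambda>s y. 1 / (1 + iu y * g s y))"
proof -
  obtain B where B: "B \<ge> 0" "\<And>s y. s \<in> S \<Longrightarrow> y \<ge> 1 \<Longrightarrow> norm (g s y) \<le> B"
    using expands_bounded[OF assms(1,2)] by metis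
  have ug: "expands S (Suc K) (\<lambda>s y. - (iu y * g s y))"
    by (intro expands_minus expands_iu_mult assms)
  have 1: "expands S (Suc K) (\<lambda>s y. \<Sum>j<Suc K. (- (iu y * g s y)) ^ j)"
    by (intro expands_sum expands_power ug assms) auto
  have 2: "expands S (Suc K) (\<lambda>s y. (- (iu y * g s y)) ^ Suc K / (1 + iu y * g s y))"
  proof (rule expands_small)
    fix s y :: real assume sy: "s \<in> S" "y \<ge> 1"
    have "norm ((- (iu y * g s y)) ^ Suc K) = (norm (g s y) / y) ^ Suc K"
      using sy by (simp only: norm_power norm_minus_cancel norm_mult norm_iu) (simp add: norm_iu)
    also have "\<dots> \<le> (B / y) ^ Suc K"
      by (intro power_mono divide_right_mono B) (use sy in auto)
    finally have "norm ((- (iu y * g s y)) ^ Suc K) / norm (1 + iu y * g s y) \<le> (B / y) ^ Suc K / c"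
      using c[OF sy] assms(3) B(1) sy by (intro frac_le) auto
    then show "norm ((- (iu y * g s y)) ^ Suc K / (1 + iu y * g s y)) \<le> (B ^ Suc K / c) / y ^ Suc K"
      by (simp add: norm_divide power_divide field_simps)
  qed
  have "1 / (1 + iu y * g s y) = (\<Sum>j<Suc K. (- (iu y * g s y)) ^ j) + (- (iu y * g s y)) ^ Suc K / (1 + iu y * g s y)"
    if sy: "s \<in> S" "y \<ge> 1" for s y
  proof -
    define v where "v = - (iu y * g s y)"
    have v: "1 - v \<noteq> 0" using c[OF sy] assms(3) by (auto simp: v_def)
    have "(\<Sum>j<Suc K. v ^ j) * (1 - v) = 1 - v ^ Suc K"
      using one_diff_power_eq[of v "Suc K"] by (simp add: mult.commute)
    then have "1 / (1 - v) = (\<Sum>j<Suc K. v ^ j) + v ^ Suc K / (1 - v)"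
      using v by (simp add: eq_divide_eq add_divide_eq_iff del: sum.lessThan_Suc power_Suc)
    then show ?thesis by (simp add: v_def)
  qed
  then show ?thesis by (rule expands_cong[OF expands_add[OF 1 2]])
qed

text \<open>The coefficients are integrated one by one. They stay real because their imaginary parts
  integrate to 0, they are continuous as indefinite integrals, and the error grows at most by the
  factor \<open>T\<close>.\<close>

lemma expands_integral:
  assumes f: "expands {0..T} K f"
    and F: "\<And>t y. t \<in> {0..T} \<Longrightarrow> y \<ge> 1 \<Longrightarrow> ((\<lambda>s. f s y) has_integral F t y) {0..t}"
  shows "expands {0..T} K F"
proof -
  obtain p C where p: "poly_path {0..T} p" "C \<ge> 0"
    "\<And>s y. s \<in> {0..T} \<Longrightarrow> y \<ge> 1 \<Longrightarrow> norm (f s y - poly (p s) (iu y)) \<le> C / y ^ K"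
    using expandsE[OF f] by metis
  obtain M where M: "\<And>s. s \<in> {0..T} \<Longrightarrow> degree (p s) \<le> M" using p(1) unfolding poly_path_def by metis
  have cont: "continuous_on {0..T} (\<lambda>s. coeff (p s) j)" for j
    using p(1) by (simp add: poly_path_def)
  define c where "c t j = integral {0..t} (\<lambda>s. coeff (p s) j)" for t j
  define q where "q t = (\<Sum>j\<le>M. monom (c t j) j)" for t
  have coeff_q: "coeff (q t) j = (if j \<le> M then c t j else 0)" for t j
    by (simp add: q_def coeff_sum if_distrib)
  have int: "((\<lambda>s. coeff (p s) j) has_integral c t j) {0..t}" if "t \<in> {0..T}" for t j
    unfolding c_def using that
    by (intro integrable_integral integrable_continuous_real continuous_on_subset[OF cont]) auto
  have "c t j \<in> \<real>" if t: "t \<in> {0..T}" for t j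
  proof -
    have "((\<lambda>s. Im (coeff (p s) j)) has_integral Im (c t j)) {0..t}"
      using has_integral_linear[OF int[OF t] bounded_linear_Im] by (simp add: o_def)
    moreover have "((\<lambda>s. Im (coeff (p s) j)) has_integral 0) {0..t}"
      by (rule has_integral_eq[OF _ has_integral_0])
        (use p(1) t in \<open>auto simp: poly_path_def real_poly_def complex_is_Real_iff\<close>)
    ultimately show ?thesis using has_integral_unique complex_is_Real_iff by blast
  qed
  then have "\<forall>t\<in>{0..T}. real_poly (q t)" by (simp add: real_poly_def coeff_q)
  moreover have "\<forall>t. degree (q t) \<le> M" by (auto intro: degree_le simp: coeff_q)
  moreover have "continuous_on {0..T} (\<lambda>t. coeff (q t) j)" for j
  proof -
    have "continuous_on {0..T} (\<lambda>t. c t j)"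
      unfolding c_def by (rule indefinite_integral_continuous_1[OF integrable_continuous_real[OF cont]])
    then show ?thesis by (cases "j \<le> M") (simp_all add: coeff_q)
  qed
  ultimately have "poly_path {0..T} q" by (auto simp: poly_path_def)
  then show ?thesis
  proof (rule expandsI)
    fix t y :: real assume ty: "t \<in> {0..T}" "y \<ge> 1"
    have "((\<lambda>s. \<Sum>j\<le>M. coeff (p s) j * iu y ^ j) has_integral (\<Sum>j\<le>M. c t j * iu y ^ j)) {0..t}"
      by (intro has_integral_sum has_integral_mult_left int ty) auto
    then have "((\<lambda>s. poly (p s) (iu y)) has_integral (\<Sum>j\<le>M. c t j * iu y ^ j)) {0..t}"
    proof (rule has_integral_eq[rotated])
      fix s assume "s \<in> {0..t}"
      then show "(\<Sum>j\<le>M. coeff (p s) j * iu y ^ j) = poly (p s) (iu y)"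
        using ty M[of s] by (simp add: poly_eq_sum_atMost)
    qed
    moreover have "(\<Sum>j\<le>M. c t j * iu y ^ j) = poly (q t) (iu y)"
      by (simp add: q_def poly_sum poly_monom)
    ultimately have "((\<lambda>s. poly (p s) (iu y)) has_integral poly (q t) (iu y)) {0..t}"
      by simp
    then have "((\<lambda>s. f s y - poly (p s) (iu y)) has_integral (F t y - poly (q t) (iu y))) {0..t}"
      by (intro has_integral_diff F ty)
    then have "norm (F t y - poly (q t) (iu y)) \<le> C / y ^ K * measure lborel {0..t}"
      unfolding box_real(2)[symmetric]
      by (rule has_integral_bound[rotated]) (use p(2) p(3) ty in auto)
    also have "\<dots> \<le> (C * T) / y ^ K"
      using ty p(2) by (auto intro!: divide_right_mono mult_left_mono)
    finally show "norm (F t y - poly (q t) (iu y)) \<le> (C * T) / y ^ K" .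
  qed
qed

section \<open>Decay of real parts forced by real coefficients\<close>

lemma Re_iu: "Re (iu y) = 0"
  by (simp add: iu_def Re_divide)

lemma poly_iu_tendsto: "((\<lambda>y. poly p (iu y)) \<longlongrightarrow> poly p 0) at_top"
  by (intro tendsto_poly tendsto_iu)

lemma tendsto_inverse_power_bound:
  fixes f :: "real \<Rightarrow> 'a::real_normed_vector"
  assumes "\<And>y. y \<ge> 1 \<Longrightarrow> norm (f y) \<le> C / y ^ K" "K > 0"
  shows "(f \<longlongrightarrow> 0) at_top"
proof (rule Lim_null_comparison)
  show "\<forall>\<^sub>F y in at_top. norm (f y) \<le> C / y ^ K"
    using eventually_ge_at_top[of 1] by eventually_elim (rule assms)
  show "((\<lambda>y. C / y ^ K) \<longlongrightarrow> 0) at_top"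
    using assms(2)
    by (intro tendsto_divide_0[OF tendsto_const] filterlim_at_top_imp_at_infinity filterlim_pow_at_top filterlim_ident)
qed

text \<open>Since \<open>\<phi>\<close> vanishes at infinity, \<open>q\<close> starts at order \<open>m + 1\<close>, and the corresponding term of
  \<open>\<phi>\<close> is a real multiple of \<open>1 / (\<i> y)\<close>, hence purely imaginary.\<close>
lemma Re_bound_of_real_poly_approx:
  assumes "real_poly q" and lim: "(\<phi> \<longlongrightarrow> 0) at_top"
    and bd: "\<And>y. y \<ge> 1 \<Longrightarrow> norm (iu y ^ m * \<phi> y - poly q (iu y)) \<le> C / y ^ (m + 2)"
  shows "\<exists>D. \<forall>y\<ge>1. \<bar>Re (\<phi> y)\<bar> \<le> D / y ^ 2"
  using assms(1) bd
proof (induction m arbitrary: q)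
  case 0
  \<comment> \<open>The function under the limit is \<open>poly q (iu y)\<close>; hence the constant
    term of \<open>q\<close> is the limit of \<phi>.\<close>
  have "((\<lambda>y. iu y ^ 0 * \<phi> y - (iu y ^ 0 * \<phi> y - poly q (iu y))) \<longlongrightarrow> 0 - 0) at_top"
    by (intro tendsto_diff tendsto_inverse_power_bound[OF 0(2)]) (use lim in auto)
  then have "poly q 0 = 0"
    using tendsto_unique[OF _ poly_iu_tendsto] by simp
  obtain a q1 where q1: "q = pCons a q1" by (cases q) auto
  obtain b q2 where q2: "q1 = pCons b q2" by (cases q1) auto
  have ab: "a = 0" "b \<in> \<real>" "real_poly q2" using \<open>poly q 0 = 0\<close> 0(1) by (simp_all add: q1 q2)
  obtain B where B: "\<And>s v. s \<in> {0::real} \<Longrightarrow> norm v \<le> 1 \<Longrightarrow> norm (poly q2 v) \<le> B"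
    using poly_path_bounded[OF poly_path_const[OF ab(3)] compact_sing] by metis
  have "\<bar>Re (\<phi> y)\<bar> \<le> (C + B) / y ^ 2" if y: "y \<ge> 1" for y
  proof -
    have eq: "poly q (iu y) = iu y * b + iu y ^ 2 * poly q2 (iu y)"
      using ab(1) by (simp add: q1 q2 power2_eq_square algebra_simps)
    have "Re (iu y * b) = 0" using ab(2) by (auto simp: Re_iu elim!: Reals_cases)
    moreover have "\<bar>Re (iu y ^ 2 * poly q2 (iu y))\<bar> \<le> B / y ^ 2"
    proof -
      have "norm (iu y ^ 2 * poly q2 (iu y)) \<le> (1 / y ^ 2) * B"
        using y B[of 0 "iu y"] by (simp add: norm_mult norm_power norm_iu power_divide divide_right_mono)
      then show ?thesis using abs_Re_le_cmod order_trans by fastforce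
    qed
    moreover have "\<bar>Re (\<phi> y - poly q (iu y))\<bar> \<le> C / y ^ 2"
      using 0(2)[OF y] abs_Re_le_cmod[of "\<phi> y - poly q (iu y)"] by (simp add: power2_eq_square)
    moreover have "Re (\<phi> y) = Re (\<phi> y - poly q (iu y)) + Re (iu y * b) + Re (iu y ^ 2 * poly q2 (iu y))"
      by (simp add: eq)
    ultimately show ?thesis unfolding add_divide_distrib by linarith
  qed
  then show ?case by blast
next
  case (Suc m)
  have "((\<lambda>y. iu y ^ Suc m * \<phi> y) \<longlongrightarrow> 0 ^ Suc m * 0) at_top"
    by (intro tendsto_mult tendsto_power tendsto_iu lim)
  then have "((\<lambda>y. iu y ^ Suc m * \<phi> y - (iu y ^ Suc m * \<phi> y - poly q (iu y))) \<longlongrightarrow> 0 - 0) at_top"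
    by (intro tendsto_diff tendsto_inverse_power_bound[OF Suc(3)]) auto
  then have "poly q 0 = 0"
    using tendsto_unique[OF _ poly_iu_tendsto] by simp
  \<comment> \<open>Without a constant term \<open>q\<close> is divisible by its variable;
    cancelling one factor \<open>iu y\<close> lowers \<open>m\<close> by one and the error order
    with it.\<close>
  obtain a q1 where q1: "q = pCons a q1" by (cases q) auto
  have "a = 0" "real_poly q1" using \<open>poly q 0 = 0\<close> Suc(2) by (simp_all add: q1)
  show ?case
  proof (rule Suc.IH[OF \<open>real_poly q1\<close>])
    fix y :: real assume y: "y \<ge> 1"
    have "iu y ^ Suc m * \<phi> y - poly q (iu y) = iu y * (iu y ^ m * \<phi> y - poly q1 (iu y))"
      by (simp add: q1 \<open>a = 0\<close> algebra_simps)
    then have "norm (iu y ^ m * \<phi> y - poly q1 (iu y)) / y \<le> C / y ^ (Suc m + 2)"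
      using Suc(3)[OF y] y by (simp add: norm_mult norm_iu)
    then show "norm (iu y ^ m * \<phi> y - poly q1 (iu y)) \<le> C / y ^ (m + 2)"
      using y by (simp add: field_simps)
  qed
qed

section \<open>Moments and resolvents\<close>

text \<open>Fatou's lemma in the form used for moments: bounded integrals of truncated powers bound
  the moment itself.\<close>

lemma nn_integral_le_of_tendsto:
  assumes "\<And>i::nat. g i \<in> borel_measurable M" "\<And>x. x \<in> space M \<Longrightarrow> (\<lambda>i. g i x) \<longlonglongrightarrow> h x"
    and "\<And>i. (\<integral>\<^sup>+x. g i x \<partial>M) \<le> C"
  shows "(\<integral>\<^sup>+x. h x \<partial>M) \<le> C"
proof -
  have "(\<integral>\<^sup>+x. h x \<partial>M) = (\<integral>\<^sup>+x. liminf (\<lambda>i. g i x) \<partial>M)"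
    by (intro nn_integral_cong) (simp add: lim_imp_Liminf[OF _ assms(2)])
  also have "\<dots> \<le> liminf (\<lambda>i. \<integral>\<^sup>+x. g i x \<partial>M)"
    by (rule nn_integral_liminf[OF assms(1)])
  also have "\<dots> \<le> C"
    by (rule order_trans[OF Liminf_le_Limsup Limsup_bounded]) (use assms(3) in auto)
  finally show ?thesis .
qed

lemma norm_of_real_diff_ge: "\<bar>Im w\<bar> \<le> norm (complex_of_real x - w)"
  using abs_Im_le_cmod[of "complex_of_real x - w"] by simp

lemma norm_kernel_le:
  assumes "Im w \<noteq> 0"
  shows "norm (1 / (complex_of_real x - w)) \<le> 1 / \<bar>Im w\<bar>"
  using norm_of_real_diff_ge[of w x] assms by (auto simp: norm_divide intro!: divide_left_mono mult_pos_pos)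

lemma of_real_neq_nonreal: "Im w \<noteq> 0 \<Longrightarrow> complex_of_real x \<noteq> w"
  by auto

definition resolvent :: "real measure \<Rightarrow> complex \<Rightarrow> complex" where
  "resolvent M w = (\<integral>x. 1 / (complex_of_real x - w) \<partial>M)"

text \<open>For nonreal \<open>w\<close> this is the total mass plus
  \<open>w * resolvent M w\<close>, hence 1 - w G(w) for a probability measure. On the imaginary
  axis its real part is the integral of x^2 / (x^2 + y^2), whose decay detects the second
  moment.\<close>

definition first_resolvent :: "real measure \<Rightarrow> complex \<Rightarrow> complex" where
  "first_resolvent M w = (\<integral>x. complex_of_real x / (complex_of_real x - w) \<partial>M)"

text \<open>The even power keeps the measure positive. The moment of order 2k + 2 of
  \<open>M\<close> is the second moment of this measure, so every induction step becomes a question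
  about second moments.\<close>

definition weighted :: "nat \<Rightarrow> real measure \<Rightarrow> real measure" where
  "weighted k M = density M (\<lambda>x. ennreal (x ^ (2 * k)))"

lemma norm_first_kernel_le:
  assumes "Im w \<noteq> 0"
  shows "norm (complex_of_real x / (complex_of_real x - w)) \<le> 1 + norm w / \<bar>Im w\<bar>"
proof -
  have "complex_of_real x / (complex_of_real x - w) = 1 + w / (complex_of_real x - w)"
    using of_real_neq_nonreal[OF assms] by (simp add: field_simps)
  also have "norm \<dots> \<le> 1 + norm w / norm (complex_of_real x - w)"
    by (rule norm_triangle_le) (simp add: norm_divide)
  also have "\<dots> \<le> 1 + norm w / \<bar>Im w\<bar>"
    using norm_of_real_diff_ge[of w x] assms by (intro add_left_mono divide_left_mono mult_pos_pos) auto
  finally show ?thesis .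
qed

text \<open>Finite Neumann series with exact remainder, obtained by iterating the identity for r. It
  is applied with r = 1 / (x - w), v = 1 / w and a = x.\<close>

lemma geometric_expansion:
  fixes r v a :: "'a::comm_ring_1"
  assumes "r = - v + v * a * r"
  shows "r = - (\<Sum>j<m. a ^ j * v ^ Suc j) + v ^ m * (a ^ m * r)"
proof (induction m)
  case (Suc m)
  have "v ^ m * (a ^ m * r) = v ^ m * (a ^ m * (- v + v * a * r))"
    using assms by simp
  also have "\<dots> = - (a ^ m * v ^ Suc m) + v ^ Suc m * (a ^ Suc m * r)"
    by (simp add: algebra_simps)
  finally have "r = - (\<Sum>j<m. a ^ j * v ^ Suc j) + (- (a ^ m * v ^ Suc m) + v ^ Suc m * (a ^ Suc m * r))"
    by (rule trans[OF Suc arg_cong[where f = "\<lambda>t. - (\<Sum>j<m. a ^ j * v ^ Suc j) + t"]])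
  also have "\<dots> = - (\<Sum>j<Suc m. a ^ j * v ^ Suc j) + v ^ Suc m * (a ^ Suc m * r)"
    by simp
  finally show ?case .
qed simp

section \<open>Resolvent integrals and moments of a finite measure\<close>

context finite_borel_measure
begin

lemma borel_measurable_eq [simp]: "borel_measurable M = borel_measurable borel"
  by (rule measurable_cong_sets[OF M_is_borel refl])

lemma space_eq_UNIV [simp]: "space M = UNIV"
  using sets_eq_imp_space_eq[OF M_is_borel] by simp

lemma integrable_bounded:
  fixes f :: "real \<Rightarrow> 'b::{banach, second_countable_topology}"
  assumes "f \<in> borel_measurable borel" "\<And>x. norm (f x) \<le> B"
  shows "integrable M f"
  by (rule integrable_const_bound[where B = B]) (use assms in auto)

lemma norm_integral_le:
  fixes f :: "real \<Rightarrow> 'b::{banach, second_countable_topology}"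
  assumes "f \<in> borel_measurable borel" "\<And>x. norm (f x) \<le> B"
  shows "norm (\<integral>x. f x \<partial>M) \<le> B * measure M UNIV"
proof -
  have "norm (\<integral>x. f x \<partial>M) \<le> (\<integral>x. norm (f x) \<partial>M)" by (rule integral_norm_bound)
  also have "\<dots> \<le> (\<integral>x. B \<partial>M)"
    by (intro integral_mono integrable_bounded[where B = B])
      (use assms order_trans[OF norm_ge_zero assms(2)] in auto)
  finally show ?thesis by (simp add: mult.commute)
qed

lemma integrable_resolvent: "Im w \<noteq> 0 \<Longrightarrow> integrable M (\<lambda>x. 1 / (complex_of_real x - w))"
  by (rule integrable_bounded[OF _ norm_kernel_le]) auto

lemma integrable_first_resolvent:
  "Im w \<noteq> 0 \<Longrightarrow> integrable M (\<lambda>x. complex_of_real x / (complex_of_real x - w))"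
  by (rule integrable_bounded[OF _ norm_first_kernel_le]) auto

lemma norm_resolvent_le: "Im w \<noteq> 0 \<Longrightarrow> norm (resolvent M w) \<le> measure M UNIV / \<bar>Im w\<bar>"
  using norm_integral_le[OF _ norm_kernel_le[of w]] by (simp add: resolvent_def)

lemma norm_first_resolvent_le:
  "Im w \<noteq> 0 \<Longrightarrow> norm (first_resolvent M w) \<le> (1 + norm w / \<bar>Im w\<bar>) * measure M UNIV"
  unfolding first_resolvent_def by (rule norm_integral_le[OF _ norm_first_kernel_le]) auto

lemma Re_first_resolvent:
  assumes "y > 0"
  shows "Re (first_resolvent M (\<i> * complex_of_real y)) = (\<integral>x. x\<^sup>2 / (x\<^sup>2 + y\<^sup>2) \<partial>M)"
proof -
  have "Re (first_resolvent M (\<i> * complex_of_real y)) =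
    (\<integral>x. Re (complex_of_real x / (complex_of_real x - \<i> * complex_of_real y)) \<partial>M)"
    unfolding first_resolvent_def using assms by (intro integral_Re[symmetric] integrable_first_resolvent) auto
  then show ?thesis by (simp add: Re_divide power2_eq_square)
qed

lemma first_resolvent_tendsto_0:
  "((\<lambda>y. first_resolvent M (\<i> * complex_of_real y)) \<longlongrightarrow> 0) at_top"
proof -
  have "((\<lambda>y. (\<integral>x. complex_of_real x / (complex_of_real x - \<i> * complex_of_real y) \<partial>M)) \<longlongrightarrow> (\<integral>x. 0 \<partial>M)) at_top"
  \<comment> \<open>The dominating constant 2 is the value of
    \<open>1 + norm w / \<bar>Im w\<bar>\<close> at w = \<i> y.\<close>
  proof (rule integral_dominated_convergence_at_top[where w = "\<lambda>x. 2"])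
    show "\<forall>\<^sub>F y in at_top. AE x in M. norm (complex_of_real x / (complex_of_real x - \<i> * complex_of_real y)) \<le> 2"
      using eventually_gt_at_top[of 0]
    proof eventually_elim
      case (elim y)
      then show ?case using norm_first_kernel_le[of "\<i> * complex_of_real y"] by (auto simp: norm_mult)
    qed
    show "AE x in M. ((\<lambda>y. complex_of_real x / (complex_of_real x - \<i> * complex_of_real y)) \<longlongrightarrow> 0) at_top"
    proof (rule AE_I2, rule Lim_null_comparison)
      fix x
      show "\<forall>\<^sub>F y in at_top. norm (complex_of_real x / (complex_of_real x - \<i> * complex_of_real y)) \<le> \<bar>x\<bar> / y"
        using eventually_gt_at_top[of 0]
      proof eventually_elim
        case (elim y)
        then show ?case using norm_of_real_diff_ge[of "\<i> * complex_of_real y" x]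
          by (auto simp: norm_divide intro!: divide_left_mono)
      qed
      show "((\<lambda>y. \<bar>x\<bar> / y) \<longlongrightarrow> 0) at_top" by real_asymp
    qed
  qed auto
  then show ?thesis by (simp add: first_resolvent_def)
qed

text \<open>Multiplied by y^2, the integrands become x^2 y^2 / (x^2 + y^2). They tend to x^2 while
  their integrals stay below \<open>D\<close>, so Fatou's lemma applies.\<close>

lemma second_moment_finite:
  assumes "\<And>y. y \<ge> 1 \<Longrightarrow> (\<integral>x. x\<^sup>2 / (x\<^sup>2 + y\<^sup>2) \<partial>M) \<le> D / y\<^sup>2"
  shows "(\<integral>\<^sup>+x. ennreal (x\<^sup>2) \<partial>M) < \<infinity>"
proof -
  have "(\<integral>\<^sup>+x. ennreal (x\<^sup>2) \<partial>M) \<le> ennreal D"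
  proof (rule nn_integral_le_of_tendsto)
    fix x
    show "(\<lambda>i. ennreal (x\<^sup>2 * real (Suc i) ^ 2 / (x\<^sup>2 + real (Suc i) ^ 2))) \<longlonglongrightarrow> ennreal (x\<^sup>2)"
      by (rule tendsto_ennrealI) real_asymp
  next
    fix i
    define y where "y = real (Suc i)"
    have y: "y \<ge> 1" by (simp add: y_def)
    have le: "x\<^sup>2 / (x\<^sup>2 + y\<^sup>2) \<le> 1" for x using y by (simp add: divide_le_eq_1 add_nonneg_pos)
    have "(\<integral>\<^sup>+x. ennreal (x\<^sup>2 * y\<^sup>2 / (x\<^sup>2 + y\<^sup>2)) \<partial>M) = (\<integral>\<^sup>+x. ennreal (y\<^sup>2 * (x\<^sup>2 / (x\<^sup>2 + y\<^sup>2))) \<partial>M)"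
      by (simp add: mult.commute[of "y\<^sup>2"])
    also have "\<dots> = ennreal (\<integral>x. y\<^sup>2 * (x\<^sup>2 / (x\<^sup>2 + y\<^sup>2)) \<partial>M)"
      by (intro nn_integral_eq_integral integrable_mult_right integrable_bounded[where B = 1])
        (use le in auto)
    also have "\<dots> \<le> ennreal D"
      using assms[OF y] y by (intro ennreal_leI, subst integral_mult_right_zero) (simp add: pos_le_divide_eq mult.commute)
    finally show "(\<integral>\<^sup>+x. ennreal (x\<^sup>2 * real (Suc i) ^ 2 / (x\<^sup>2 + real (Suc i) ^ 2)) \<partial>M) \<le> ennreal D"
      by (simp add: y_def)
  qed auto
  also have "\<dots> < \<infinity>" by simp
  finally show ?thesis .
qed

lemma integrable_moment:
  assumes "(\<integral>\<^sup>+x. ennreal (x ^ (2 * k)) \<partial>M) < \<infinity>" "j \<le> 2 * k"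
  shows "integrable M (\<lambda>x. x ^ j)"
proof (rule Bochner_Integration.integrable_bound)
  have "integrable M (\<lambda>x. x ^ (2 * k))"
    by (rule integrableI_nonneg) (use assms in auto)
  then show "integrable M (\<lambda>x. 1 + x ^ (2 * k))" by simp
  have "\<bar>x\<bar> ^ j \<le> 1 + x ^ (2 * k)" for x :: real
  proof (cases "\<bar>x\<bar> \<le> 1")
    case True
    then have "\<bar>x\<bar> ^ j \<le> 1" by (simp add: power_le_one)
    then show ?thesis by (simp add: add_increasing2)
  next
    case False
    then have "\<bar>x\<bar> ^ j \<le> \<bar>x\<bar> ^ (2 * k)" using assms(2) by (intro power_increasing) auto
    then show ?thesis by (simp add: power_even_abs)
  qed
  then show "AE x in M. norm (x ^ j) \<le> norm (1 + x ^ (2 * k))"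
    by (auto simp: power_abs)
qed auto

lemma weighted_finite_borel_measure:
  assumes "(\<integral>\<^sup>+x. ennreal (x ^ (2 * k)) \<partial>M) < \<infinity>"
  shows "finite_borel_measure (weighted k M)"
proof -
  have "emeasure (weighted k M) (space (weighted k M)) \<noteq> \<infinity>"
    using assms emeasure_density[of "\<lambda>x. ennreal (x ^ (2 * k))" M UNIV] by (simp add: weighted_def M_is_borel)
  then interpret finite_measure "weighted k M" by (rule finite_measureI)
  show ?thesis by unfold_locales (simp add: weighted_def M_is_borel)
qed

lemma nn_integral_weighted:
  "(\<integral>\<^sup>+x. ennreal (x\<^sup>2) \<partial>weighted k M) = (\<integral>\<^sup>+x. ennreal (x ^ (2 * Suc k)) \<partial>M)"
  by (simp add: weighted_def nn_integral_density ennreal_mult[symmetric] power_add[symmetric])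

lemma integral_weighted:
  fixes f :: "real \<Rightarrow> complex"
  assumes "f \<in> borel_measurable borel"
  shows "(\<integral>x. f x \<partial>weighted k M) = (\<integral>x. complex_of_real (x ^ (2 * k)) * f x \<partial>M)"
  unfolding weighted_def
  by (subst integral_density) (use assms in \<open>auto simp: scaleR_conv_of_real\<close>)

lemma integrable_moment_mult:
  fixes g :: "real \<Rightarrow> complex"
  assumes fin: "(\<integral>\<^sup>+x. ennreal (x ^ (2 * k)) \<partial>M) < \<infinity>"
    and g: "g \<in> borel_measurable borel" "\<And>x. norm (g x) \<le> B"
  shows "integrable M (\<lambda>x. complex_of_real x ^ (2 * k) * g x)"
proof (rule Bochner_Integration.integrable_bound)
  show "integrable M (\<lambda>x. B * x ^ (2 * k))"
    by (intro integrable_mult_right integrable_moment[OF fin]) auto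
  show "AE x in M. norm (complex_of_real x ^ (2 * k) * g x) \<le> norm (B * x ^ (2 * k))"
  proof (rule AE_I2)
    fix x :: real
    have "norm (g x) * x ^ (2 * k) \<le> B * x ^ (2 * k)" by (intro mult_right_mono g) auto
    then show "norm (complex_of_real x ^ (2 * k) * g x) \<le> norm (B * x ^ (2 * k))"
      by (simp add: norm_mult norm_power power_even_abs mult.commute)
  qed
qed (use g in auto)

text \<open>The geometric expansion of 1 / (x - w), multiplied by x^i, is integrated term by term.
  As j < 2k and i \<le> 1, only moments of order at most 2k occur, and these exist. The factor
  x^(2k) of the remainder is absorbed into the weighted measure.\<close>

lemma kernel_integral_expansion:
  assumes fin: "(\<integral>\<^sup>+x. ennreal (x ^ (2 * k)) \<partial>M) < \<infinity>" and "i \<le> 1"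
    and bd: "\<And>w. Im w \<noteq> 0 \<Longrightarrow> \<exists>B. \<forall>x. norm (complex_of_real x ^ i / (complex_of_real x - w)) \<le> B"
  obtains q where "real_poly q"
    "\<And>w. Im w \<noteq> 0 \<Longrightarrow> (\<integral>x. complex_of_real x ^ i / (complex_of_real x - w) \<partial>M) =
      1 / w * poly q (1 / w) + (1 / w) ^ (2 * k) * (\<integral>x. complex_of_real x ^ i / (complex_of_real x - w) \<partial>weighted k M)"
proof
  define c where "c j = complex_of_real (\<integral>x. x ^ j \<partial>M)" for j
  let ?q = "- (\<Sum>j<2*k. monom (c (i + j)) j)"
  show "real_poly ?q"
    by (auto simp: real_poly_def coeff_sum c_def)
  fix w :: complex assume w: "Im w \<noteq> 0"
  obtain B where B: "\<And>x. norm (complex_of_real x ^ i / (complex_of_real x - w)) \<le> B"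
    using bd[OF w] by blast
  define v where "v = 1 / w"
  have c: "has_bochner_integral M (\<lambda>x. complex_of_real x ^ (i + j)) (c (i + j))" if "j < 2 * k" for j
  proof -
    have "integrable M (\<lambda>x. x ^ (i + j))"
      by (rule integrable_moment[OF fin]) (use that assms(2) in auto)
    then have "has_bochner_integral M (\<lambda>x. of_real (x ^ (i + j))) (c (i + j))"
      unfolding c_def by (intro has_bochner_integral_of_real has_bochner_integral_integrable)
    then show ?thesis by simp
  qed
  have "has_bochner_integral M (\<lambda>x. - (\<Sum>j<2*k. complex_of_real x ^ (i + j) * v ^ Suc j) +
      v ^ (2 * k) * (complex_of_real x ^ (2 * k) * (complex_of_real x ^ i / (complex_of_real x - w))))
    (- (\<Sum>j<2*k. c (i + j) * v ^ Suc j) + v ^ (2 * k) *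
      (\<integral>x. complex_of_real x ^ (2 * k) * (complex_of_real x ^ i / (complex_of_real x - w)) \<partial>M))"
    by (intro has_bochner_integral_add has_bochner_integral_minus has_bochner_integral_sum
        has_bochner_integral_mult_left has_bochner_integral_mult_right has_bochner_integral_integrable
        integrable_moment_mult[OF fin _ B] c) auto
  moreover have "- (\<Sum>j<2*k. complex_of_real x ^ (i + j) * v ^ Suc j) +
      v ^ (2 * k) * (complex_of_real x ^ (2 * k) * (complex_of_real x ^ i / (complex_of_real x - w))) =
      complex_of_real x ^ i / (complex_of_real x - w)" for x
  proof -
    have "1 / (complex_of_real x - w) = - v + v * of_real x * (1 / (complex_of_real x - w))"
      using of_real_neq_nonreal[OF w, of x] w unfolding v_def
      by (simp add: divide_eq_eq eq_divide_eq ring_distribs) (auto simp: field_simps)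
    from geometric_expansion[OF this, of "2 * k"]
    have "of_real x ^ i * (1 / (complex_of_real x - w)) = of_real x ^ i *
      (- (\<Sum>j<2*k. of_real x ^ j * v ^ Suc j) + v ^ (2 * k) * (of_real x ^ (2 * k) * (1 / (complex_of_real x - w))))"
      by (rule arg_cong)
    then show ?thesis by (simp add: algebra_simps sum_distrib_left power_add)
  qed
  ultimately have "(\<integral>x. complex_of_real x ^ i / (complex_of_real x - w) \<partial>M) =
     - (\<Sum>j<2*k. c (i + j) * v ^ Suc j) + v ^ (2 * k) *
      (\<integral>x. complex_of_real x ^ (2 * k) * (complex_of_real x ^ i / (complex_of_real x - w)) \<partial>M)"
    by (simp add: has_bochner_integral_integral_eq)
  moreover have "v * poly ?q v = - (\<Sum>j<2*k. c (i + j) * v ^ Suc j)"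
    by (simp add: poly_sum poly_monom sum_distrib_left mult.left_commute)
  ultimately show "(\<integral>x. complex_of_real x ^ i / (complex_of_real x - w) \<partial>M) =
      1 / w * poly ?q (1 / w) + (1 / w) ^ (2 * k) * (\<integral>x. complex_of_real x ^ i / (complex_of_real x - w) \<partial>weighted k M)"
    by (simp add: v_def integral_weighted)
qed

lemma resolvent_expansion:
  assumes fin: "(\<integral>\<^sup>+x. ennreal (x ^ (2 * k)) \<partial>M) < \<infinity>"
  obtains q where "real_poly q"
    "\<And>w. Im w \<noteq> 0 \<Longrightarrow> resolvent M w = 1 / w * poly q (1 / w) + (1 / w) ^ (2 * k) * resolvent (weighted k M) w"
proof (rule kernel_integral_expansion[OF fin, of 0])
  show "\<exists>B. \<forall>x. norm (complex_of_real x ^ 0 / (complex_of_real x - w)) \<le> B" if "Im w \<noteq> 0" for w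
    using norm_kernel_le[OF that] by auto
qed (auto simp: resolvent_def intro: that)

lemma first_resolvent_expansion:
  assumes fin: "(\<integral>\<^sup>+x. ennreal (x ^ (2 * k)) \<partial>M) < \<infinity>"
  obtains q where "real_poly q"
    "\<And>w. Im w \<noteq> 0 \<Longrightarrow> first_resolvent M w = 1 / w * poly q (1 / w) + (1 / w) ^ (2 * k) * first_resolvent (weighted k M) w"
proof (rule kernel_integral_expansion[OF fin, of 1])
  show "\<exists>B. \<forall>x. norm (complex_of_real x ^ 1 / (complex_of_real x - w)) \<le> B" if "Im w \<noteq> 0" for w
    using norm_first_kernel_le[OF that] by auto
qed (auto simp: first_resolvent_def intro: that)

end

lemma one_div_iy: "1 / (\<i> * complex_of_real y) = iu y"
  by (simp add: iu_def)

context finite_borel_measure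
begin

text \<open>Induction on k: the moments found so far determine the expansion up to
  \<open>iu y ^ (2 * k)\<close> times the first resolvent of the weighted measure. Comparison with
  the hypothesis shows that the real part of the latter is O(y^(-2)), which yields two more
  orders.\<close>

lemma moment_finite_of_expands:
  assumes exp: "expands {t} (2 * n) (\<lambda>s y. first_resolvent M (\<i> * complex_of_real y))"
  shows "k \<le> n \<Longrightarrow> (\<integral>\<^sup>+x. ennreal (x ^ (2 * k)) \<partial>M) < \<infinity>"
proof (induction k)
  case 0
  then show ?case using emeasure_finite[of UNIV] by (simp add: less_top[symmetric])
next
  case (Suc k)
  then have fin: "(\<integral>\<^sup>+x. ennreal (x ^ (2 * k)) \<partial>M) < \<infinity>" by simp
  interpret W: finite_borel_measure "weighted k M"
    by (rule weighted_finite_borel_measure[OF fin])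
  obtain q where q: "real_poly q" "\<And>w. Im w \<noteq> 0 \<Longrightarrow> first_resolvent M w =
      1 / w * poly q (1 / w) + (1 / w) ^ (2 * k) * first_resolvent (weighted k M) w"
    using first_resolvent_expansion[OF fin] by metis
  obtain p C where p: "poly_path {t} p" "C \<ge> 0" "\<And>s y. s \<in> {t} \<Longrightarrow> y \<ge> 1 \<Longrightarrow>
      norm (first_resolvent M (\<i> * complex_of_real y) - poly (p s) (iu y)) \<le> C / y ^ (2 * n)"
    using expandsE[OF exp] by metis
  have "\<exists>D. \<forall>y\<ge>1. \<bar>Re (first_resolvent (weighted k M) (\<i> * complex_of_real y))\<bar> \<le> D / y ^ 2"
  proof (rule Re_bound_of_real_poly_approx[OF _ W.first_resolvent_tendsto_0])
    \<comment> \<open>\<open>pCons 0 q\<close> accounts for the factor 1 / w in front of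
      \<open>poly q (1 / w)\<close>.\<close>
    show "real_poly (p t - pCons 0 q)"
      using p(1) q(1) by (intro real_poly_diff) (auto simp: poly_path_def)
    fix y :: real assume y: "y \<ge> 1"
    have "norm (first_resolvent M (\<i> * complex_of_real y) - poly (p t) (iu y)) \<le> C / y ^ (2 * n)"
      using p(3) y by simp
    also have "\<dots> \<le> C / y ^ (2 * k + 2)"
      using p(2) y Suc.prems by (intro divide_left_mono power_increasing) auto
    finally show "norm (iu y ^ (2 * k) * first_resolvent (weighted k M) (\<i> * complex_of_real y) -
       poly (p t - pCons 0 q) (iu y)) \<le> C / y ^ (2 * k + 2)"
      using q(2)[of "\<i> * complex_of_real y"] y by (simp add: one_div_iy algebra_simps)
  qed
  then obtain D where "\<And>y. y \<ge> 1 \<Longrightarrow> \<bar>Re (first_resolvent (weighted k M) (\<i> * complex_of_real y))\<bar> \<le> D / y ^ 2"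
    by blast
  then have "(\<integral>x. x\<^sup>2 / (x\<^sup>2 + y\<^sup>2) \<partial>weighted k M) \<le> D / y\<^sup>2" if "y \<ge> 1" for y
    using W.Re_first_resolvent[of y] that by fastforce
  then show ?case using W.second_moment_finite nn_integral_weighted by metis
qed

lemma norm_first_resolvent_iy_le:
  "y > 0 \<Longrightarrow> norm (first_resolvent M (\<i> * complex_of_real y)) \<le> 2 * measure M UNIV"
  using norm_first_resolvent_le[of "\<i> * complex_of_real y"] by (simp add: norm_mult)

text \<open>The factor \<i> y cancels the leading 1 / w of the expansion of the first resolvent. It
  also takes one power from the remainder, which leaves the order 2n - 1.\<close>

lemma expands_of_moment_finite:
  assumes fin: "(\<integral>\<^sup>+x. ennreal (x ^ (2 * n)) \<partial>M) < \<infinity>" and "n \<ge> 1"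
  shows "expands S (2 * n - 1) (\<lambda>s y. \<i> * complex_of_real y * first_resolvent M (\<i> * complex_of_real y))"
proof -
  interpret W: finite_borel_measure "weighted n M"
    by (rule weighted_finite_borel_measure[OF fin])
  obtain q where q: "real_poly q" "\<And>w. Im w \<noteq> 0 \<Longrightarrow> first_resolvent M w =
      1 / w * poly q (1 / w) + (1 / w) ^ (2 * n) * first_resolvent (weighted n M) w"
    using first_resolvent_expansion[OF fin] by metis
  show ?thesis
  proof (rule expandsI[OF poly_path_const[OF q(1)]])
    fix s y :: real assume y: "y \<ge> 1"
    have "\<i> * complex_of_real y * first_resolvent M (\<i> * complex_of_real y) - poly q (iu y) =
        iu y ^ (2 * n - 1) * first_resolvent (weighted n M) (\<i> * complex_of_real y)"
    proof -
      have "iu y ^ (2 * n) = iu y * iu y ^ (2 * n - 1)"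
        using assms(2) by (simp flip: power_Suc)
      then have "\<i> * complex_of_real y * first_resolvent M (\<i> * complex_of_real y) =
        (iu y * (\<i> * complex_of_real y)) * (poly q (iu y) + iu y ^ (2 * n - 1) * first_resolvent (weighted n M) (\<i> * complex_of_real y))"
        using q(2)[of "\<i> * complex_of_real y"] y by (simp add: one_div_iy algebra_simps)
      then show ?thesis using iu_mult_iy[of y] y by simp
    qed
    also have "norm \<dots> \<le> (1 / y ^ (2 * n - 1)) * (2 * measure (weighted n M) UNIV)"
      unfolding norm_mult norm_power
      using y W.norm_first_resolvent_iy_le[of y] by (intro mult_mono) (auto simp: norm_iu power_divide)
    finally show "norm (\<i> * complex_of_real y * first_resolvent M (\<i> * complex_of_real y) - poly q (iu y))
      \<le> (2 * measure (weighted n M) UNIV) / y ^ (2 * n - 1)" by simp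
  qed
qed

section \<open>Positivity and expansion of the generator\<close>

lemma integrable_gen_kernel:
  assumes "Im w \<noteq> 0"
  shows "integrable M (\<lambda>x. (1 + complex_of_real x * w) / (complex_of_real x - w))"
proof -
  have "integrable M (\<lambda>x. 1 / (complex_of_real x - w) + w * (complex_of_real x / (complex_of_real x - w)))"
    by (intro Bochner_Integration.integrable_add integrable_mult_right integrable_resolvent
        integrable_first_resolvent assms)
  then show ?thesis by (simp add: add_divide_distrib mult.commute)
qed

lemma gen_A_eq:
  assumes "Im w \<noteq> 0"
  shows "gen_A \<gamma> M w = - complex_of_real \<gamma> + (resolvent M w + w * first_resolvent M w)"
proof -
  have "resolvent M w + w * first_resolvent M w =
    (\<integral>x. 1 / (complex_of_real x - w) + w * (complex_of_real x / (complex_of_real x - w)) \<partial>M)"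
    unfolding resolvent_def first_resolvent_def
    by (subst Bochner_Integration.integral_add[OF integrable_resolvent[OF assms] integrable_mult_right[OF integrable_first_resolvent[OF assms]]])
      (simp only: integral_mult_right_zero)
  then show ?thesis by (simp add: gen_A_def add_divide_distrib mult.commute)
qed

text \<open>The imaginary part of the kernel is Im w (1 + x^2) / |x - w|^2. Its sign makes imaginary
  parts grow along the flow in the upper half-plane, and its size controls the second moment of the
  measure.\<close>

lemma Im_gen_A:
  assumes "Im w \<noteq> 0"
  shows "integrable M (\<lambda>x. (1 + x\<^sup>2) / (cmod (complex_of_real x - w))\<^sup>2)"
    and "Im (gen_A \<gamma> M w) = Im w * (\<integral>x. (1 + x\<^sup>2) / (cmod (complex_of_real x - w))\<^sup>2 \<partial>M)"
proof -
  have eq: "Im ((1 + complex_of_real x * w) / (complex_of_real x - w)) =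
      Im w * ((1 + x\<^sup>2) / (cmod (complex_of_real x - w))\<^sup>2)" for x
    by (simp add: Im_divide cmod_power2) (simp add: power2_eq_square algebra_simps)
  have int: "integrable M (\<lambda>x. Im w * ((1 + x\<^sup>2) / (cmod (complex_of_real x - w))\<^sup>2))"
    using integrable_Im[OF integrable_gen_kernel[OF assms]] by (simp only: eq)
  then show "integrable M (\<lambda>x. (1 + x\<^sup>2) / (cmod (complex_of_real x - w))\<^sup>2)"
    using integrable_mult_right[OF int, of "1 / Im w"] assms by simp
  have "Im (gen_A \<gamma> M w) = (\<integral>x. Im ((1 + complex_of_real x * w) / (complex_of_real x - w)) \<partial>M)"
    unfolding gen_A_def using integral_Im[OF integrable_gen_kernel[OF assms]] by simp
  then show "Im (gen_A \<gamma> M w) = Im w * (\<integral>x. (1 + x\<^sup>2) / (cmod (complex_of_real x - w))\<^sup>2 \<partial>M)"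
    by (simp only: eq integral_mult_right_zero)
qed

text \<open>In \<open>w * first_resolvent M w\<close> the factor w cancels one 1 / w, whence the
  exponent 2k - 1. The remainder is kept exact because the converse direction needs more than its
  order of magnitude.\<close>

lemma gen_A_expansion:
  assumes fin: "(\<integral>\<^sup>+x. ennreal (x ^ (2 * k)) \<partial>M) < \<infinity>" and "k \<ge> 1"
  obtains P where "real_poly P"
    "\<And>w. Im w \<noteq> 0 \<Longrightarrow> gen_A \<gamma> M w = poly P (1 / w) +
      ((1 / w) ^ (2 * k - 1) * first_resolvent (weighted k M) w + (1 / w) ^ (2 * k) * resolvent (weighted k M) w)"
proof -
  obtain q0 where q0: "real_poly q0" "\<And>w. Im w \<noteq> 0 \<Longrightarrow> resolvent M w =
      1 / w * poly q0 (1 / w) + (1 / w) ^ (2 * k) * resolvent (weighted k M) w"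
    using resolvent_expansion[OF fin] by metis
  obtain q1 where q1: "real_poly q1" "\<And>w. Im w \<noteq> 0 \<Longrightarrow> first_resolvent M w =
      1 / w * poly q1 (1 / w) + (1 / w) ^ (2 * k) * first_resolvent (weighted k M) w"
    using first_resolvent_expansion[OF fin] by metis
  show ?thesis
  proof
    show "real_poly (pCons (- of_real \<gamma>) q0 + q1)"
      using q0(1) q1(1) by (intro real_poly_add) auto
    fix w :: complex assume w: "Im w \<noteq> 0"
    define v where "v = 1 / w"
    have wv: "w * v = 1" using w by (auto simp: v_def)
    have "v ^ (2 * k) = v * v ^ (2 * k - 1)" using assms(2) by (simp flip: power_Suc)
    then have "w * first_resolvent M w = (w * v) * poly q1 v + (w * v) * (v ^ (2 * k - 1) * first_resolvent (weighted k M) w)"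
      using q1(2)[OF w] by (simp add: v_def[symmetric] algebra_simps)
    then show "gen_A \<gamma> M w = poly (pCons (- of_real \<gamma>) q0 + q1) (1 / w) +
      ((1 / w) ^ (2 * k - 1) * first_resolvent (weighted k M) w + (1 / w) ^ (2 * k) * resolvent (weighted k M) w)"
      unfolding gen_A_eq[OF w] q0(2)[OF w] wv v_def[symmetric] by simp
  qed
qed

text \<open>The bound is in terms of \<open>Im w\<close> because the flow leaves the imaginary axis.
  The ratio \<open>norm w / Im w\<close> in the estimate of \<open>first_resolvent\<close> is
  absorbed by one of the 2k - 1 factors 1 / w. That term contributes 2 to the constant and the
  \<open>resolvent\<close> term contributes 1.\<close>

lemma gen_A_approx:
  assumes fin: "(\<integral>\<^sup>+x. ennreal (x ^ (2 * k)) \<partial>M) < \<infinity>" and k: "k \<ge> 1"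
    and eq: "Im w \<noteq> 0 \<Longrightarrow> gen_A \<gamma> M w = poly P (1 / w) +
      ((1 / w) ^ (2 * k - 1) * first_resolvent (weighted k M) w + (1 / w) ^ (2 * k) * resolvent (weighted k M) w)"
    and w: "Im w \<ge> 1"
  shows "norm (gen_A \<gamma> M w - poly P (1 / w)) \<le> 3 * measure (weighted k M) UNIV / Im w ^ (2 * k - 1)"
proof -
  interpret W: finite_borel_measure "weighted k M"
    by (rule weighted_finite_borel_measure[OF fin])
  define m where "m = measure (weighted k M) UNIV"
  have m: "m \<ge> 0" by (simp add: m_def)
  define a where "a = norm w"
  define b where "b = Im w"
  have b: "b \<ge> 1" "b \<le> a" using w abs_Im_le_cmod[of w] by (auto simp: a_def b_def)
  obtain j where j: "k = Suc j" using k by (cases k) auto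
  have le: "(1 / a) ^ i \<le> (1 / b) ^ i" for i
    using b by (intro power_mono divide_left_mono) auto
  have "norm ((1 / w) ^ (2 * k - 1) * first_resolvent (weighted k M) w) \<le> (1 / a) ^ Suc (2 * j) * ((1 + a / b) * m)"
    using W.norm_first_resolvent_le[of w] w unfolding norm_mult norm_power norm_divide
    by (intro mult_mono) (auto simp: a_def b_def m_def j)
  also have "\<dots> = m * ((1 / a) ^ Suc (2 * j) + (1 / a) ^ (2 * j) / b)"
    using b by (simp add: field_simps)
  also have "\<dots> \<le> m * ((1 / b) ^ Suc (2 * j) + (1 / b) ^ (2 * j) / b)"
    using b m by (intro mult_left_mono add_mono le divide_right_mono) auto
  also have "\<dots> = 2 * m / b ^ (2 * k - 1)"
    by (simp add: j power_divide)
  finally have 1: "norm ((1 / w) ^ (2 * k - 1) * first_resolvent (weighted k M) w) \<le> 2 * m / b ^ (2 * k - 1)" .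
  have "norm ((1 / w) ^ (2 * k) * resolvent (weighted k M) w) \<le> (1 / a) ^ (2 * k) * (m / b)"
    using W.norm_resolvent_le[of w] w unfolding norm_mult norm_power norm_divide
    by (intro mult_mono) (auto simp: a_def b_def m_def)
  also have "\<dots> \<le> (1 / b) ^ (2 * k) * m"
    using b m by (intro mult_mono le) (auto simp: divide_le_eq mult_le_cancel_left1)
  also have "\<dots> \<le> (1 / b) ^ (2 * k - 1) * m"
    using b m by (intro mult_right_mono power_decreasing) auto
  finally have 2: "norm ((1 / w) ^ (2 * k) * resolvent (weighted k M) w) \<le> m / b ^ (2 * k - 1)"
    by (simp add: power_divide)
  have "gen_A \<gamma> M w - poly P (1 / w) = (1 / w) ^ (2 * k - 1) * first_resolvent (weighted k M) w +
     (1 / w) ^ (2 * k) * resolvent (weighted k M) w"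
    using eq w by simp
  also have "norm \<dots> \<le> 2 * m / b ^ (2 * k - 1) + m / b ^ (2 * k - 1)"
    by (rule norm_triangle_le[OF add_mono[OF 1 2]])
  finally show ?thesis by (simp add: m_def b_def add_divide_distrib[symmetric])
qed

end

section \<open>Expansions along the flow\<close>

text \<open>Write h = \<i> y (1 + \<open>iu y\<close> (h - \<i> y)). Inverting the bracket, whose
  norm is at least 1 by the lower bound on Im h, gains one order, and the remaining factor
  \<open>iu y\<close> gains the second.\<close>

lemma expands_inverse_shift:
  assumes "expands S K (\<lambda>s y. h s y - \<i> * complex_of_real y)" "compact S"
    and "\<And>s y. s \<in> S \<Longrightarrow> y \<ge> 1 \<Longrightarrow> y \<le> Im (h s y)"
  shows "expands S (Suc K) (\<lambda>s y. \<i> * complex_of_real y / h s y)"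
    and "expands S (Suc (Suc K)) (\<lambda>s y. 1 / h s y)"
proof -
  have eq: "1 + iu y * (h s y - \<i> * complex_of_real y) = iu y * h s y" if "y \<ge> 1" for s y
    using that iu_mult_iy[of y] by (simp add: algebra_simps)
  have inv: "expands S (Suc K) (\<lambda>s y. 1 / (1 + iu y * (h s y - \<i> * complex_of_real y)))"
  proof (rule expands_inverse[OF assms(1,2), of 1])
    fix s y :: real assume sy: "s \<in> S" "y \<ge> 1"
    have "1 \<le> norm (h s y) / y"
      using assms(3)[OF sy] abs_Im_le_cmod[of "h s y"] sy by (simp add: le_divide_eq)
    then show "1 \<le> norm (1 + iu y * (h s y - \<i> * complex_of_real y))"
      using sy by (simp add: eq norm_mult norm_iu)
  qed simp
  have eq2: "1 / (1 + iu y * (h s y - \<i> * complex_of_real y)) = \<i> * complex_of_real y / h s y"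
    if "y \<ge> 1" for s y
    using that unfolding eq[OF that] by (simp add: iu_def)
  show *: "expands S (Suc K) (\<lambda>s y. \<i> * complex_of_real y / h s y)"
    by (rule expands_cong[OF inv]) (simp add: eq2)
  show "expands S (Suc (Suc K)) (\<lambda>s y. 1 / h s y)"
    by (rule expands_cong[OF expands_iu_mult[OF *]]) (simp add: iu_def)
qed

text \<open>Each pass through the differential equation gains one order, because inverting a perturbation
  of \<open>\<i> y\<close> gains two.\<close>
lemma expands_of_flow:
  fixes h :: "real \<Rightarrow> real \<Rightarrow> complex"
  assumes Im: "\<And>s y. s \<in> {0..T} \<Longrightarrow> y \<ge> 1 \<Longrightarrow> y \<le> Im (h s y)"
    and flow: "\<And>t y. t \<in> {0..T} \<Longrightarrow> y \<ge> 1 \<Longrightarrow>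
      ((\<lambda>s. A (h s y)) has_integral h t y - \<i> * complex_of_real y) {0..t}"
    and P: "real_poly P"
    and approx: "\<And>w. Im w \<ge> 1 \<Longrightarrow> norm (A w - poly P (1 / w)) \<le> C / Im w ^ K"
  shows "expands {0..T} K (\<lambda>s y. h s y - \<i> * complex_of_real y)"
proof -
  have C: "C \<ge> 0" using order_trans[OF norm_ge_zero approx[of \<i>]] by simp
  have err: "expands {0..T} K (\<lambda>s y. A (h s y) - poly P (1 / h s y))"
  proof (rule expands_small)
    fix s y :: real assume sy: "s \<in> {0..T}" "y \<ge> 1"
    have "norm (A (h s y) - poly P (1 / h s y)) \<le> C / Im (h s y) ^ K"
      using sy Im[OF sy] by (intro approx) auto
    also have "\<dots> \<le> C / y ^ K"
      using C sy Im[OF sy] by (intro divide_left_mono power_mono) auto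
    finally show "norm (A (h s y) - poly P (1 / h s y)) \<le> C / y ^ K" .
  qed
  \<comment> \<open>The integrated differential equation turns an expansion of A along the flow into
    one of h of the same order.\<close>
  have step: "expands {0..T} k (\<lambda>s y. h s y - \<i> * complex_of_real y)"
    if "k \<le> K" "expands {0..T} k (\<lambda>s y. poly P (1 / h s y))" for k
  proof (rule expands_integral)
    have "expands {0..T} k (\<lambda>s y. (A (h s y) - poly P (1 / h s y)) + poly P (1 / h s y))"
      using expands_mono[OF err that(1)] that(2) by (rule expands_add)
    then show "expands {0..T} k (\<lambda>s y. A (h s y))" by simp
  qed (rule flow)
  have "k \<le> K \<Longrightarrow> expands {0..T} k (\<lambda>s y. h s y - \<i> * complex_of_real y)" for k
  proof (induction k)
    case 0
    \<comment> \<open>At order 0 boundedness is enough: 1 / h lies in the closed unit disc, where P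
      is bounded.\<close>
    obtain B where B: "\<And>s v. s \<in> {0::real} \<Longrightarrow> norm v \<le> 1 \<Longrightarrow> norm (poly P v) \<le> B"
      using poly_path_bounded[OF poly_path_const[OF P] compact_sing] by metis
    show ?case
    proof (rule step)
      show "expands {0..T} 0 (\<lambda>s y. poly P (1 / h s y))"
      proof (rule expands_small)
        fix s y :: real assume sy: "s \<in> {0..T}" "y \<ge> 1"
        have "norm (1 / h s y) \<le> 1"
          using Im[OF sy] sy abs_Im_le_cmod[of "h s y"] by (simp add: norm_divide divide_le_eq_1)
        then show "norm (poly P (1 / h s y)) \<le> B / y ^ 0" using B[of 0] by simp
      qed
    qed simp
  next
    case (Suc k)
    then have "expands {0..T} k (\<lambda>s y. h s y - \<i> * complex_of_real y)" by simp
    then have "expands {0..T} (Suc (Suc k)) (\<lambda>s y. poly P (1 / h s y))"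
      by (intro expands_poly_comp[OF expands_inverse_shift(2) _ P] Im) auto
    \<comment> \<open>Order k + 2 is available for P(1 / h), and order k + 1 is taken.\<close>
    then show ?case by (intro step Suc.prems) (rule expands_mono, auto)
  qed
  then show ?thesis by simp
qed

section \<open>Reciprocal Cauchy transforms\<close>

sublocale real_distribution \<subseteq> finite_borel_measure
  by (rule finite_borel_measure_M)

context real_distribution
begin

lemma integrable_cauchy_kernel:
  "Im z \<noteq> 0 \<Longrightarrow> integrable M (\<lambda>x. 1 / (z - complex_of_real x))"
  using integrable_minus[OF integrable_resolvent[of z]] by (simp add: minus_divide_right)

lemma mult_cauchy_G:
  assumes "Im z \<noteq> 0"
  shows "z * cauchy_G M z = 1 - first_resolvent M z"
proof -
  have "z * cauchy_G M z = (\<integral>x. z * (1 / (z - complex_of_real x)) \<partial>M)"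
    unfolding cauchy_G_def by (rule integral_mult_right_zero[symmetric])
  also have "\<dots> = (\<integral>x. 1 - complex_of_real x / (complex_of_real x - z) \<partial>M)"
  proof (rule Bochner_Integration.integral_cong[OF refl])
    fix x
    show "z * (1 / (z - complex_of_real x)) = 1 - complex_of_real x / (complex_of_real x - z)"
      using of_real_neq_nonreal[OF assms, of x] by (simp add: field_simps)
  qed
  also have "\<dots> = 1 - first_resolvent M z"
    unfolding first_resolvent_def using integrable_first_resolvent[OF assms] prob_space by simp
  finally show ?thesis .
qed

lemma Im_cauchy_G_neg:
  assumes "Im z > 0"
  shows "Im (cauchy_G M z) < 0"
proof -
  have Im: "Im (1 / (z - complex_of_real x)) = - (Im z / (cmod (z - complex_of_real x))\<^sup>2)" for x
    by (simp add: Im_divide cmod_power2)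
  have int: "integrable M (\<lambda>x. Im z / (cmod (z - complex_of_real x))\<^sup>2)"
    using integrable_Im[OF integrable_cauchy_kernel[of z]] assms by (simp add: Im del: Im_divide_of_real)
  have pos: "Im z / (cmod (z - complex_of_real x))\<^sup>2 > 0" for x
    using assms by (auto intro!: divide_pos_pos)
  have "0 < (\<integral>x. Im z / (cmod (z - complex_of_real x))\<^sup>2 \<partial>M)"
    using integral_less_AE_space[of "\<lambda>x. 0" "\<lambda>x. Im z / (cmod (z - complex_of_real x))\<^sup>2"] int pos emeasure_space_1
    by simp
  moreover have "Im (cauchy_G M z) = (\<integral>x. - (Im z / (cmod (z - complex_of_real x))\<^sup>2) \<partial>M)"
    unfolding cauchy_G_def Im[symmetric] using assms by (intro integral_Im[symmetric] integrable_cauchy_kernel) auto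
  ultimately show ?thesis by simp
qed

lemma Im_recip_H_pos:
  assumes "Im z > 0"
  shows "Im (recip_H M z) > 0"
  using Im_cauchy_G_neg[OF assms] by (auto simp: recip_H_def Im_divide intro!: divide_neg_pos add_nonneg_pos)

text \<open>The real part of the right-hand quantity is the integral of y^2 / (x^2 + y^2), which
  increases with y and equals the left-hand side at y = 1. This gives a lower bound independent of
  y.\<close>

lemma norm_one_minus_first_resolvent_ge:
  assumes "y \<ge> 1"
  shows "(\<integral>x. 1 / (1 + x\<^sup>2) \<partial>M) \<le> norm (1 - first_resolvent M (\<i> * complex_of_real y))"
proof -
  have pos: "x\<^sup>2 + y\<^sup>2 > 0" for x using assms by (simp add: add_nonneg_pos)
  have "(\<integral>x. 1 / (1 + x\<^sup>2) \<partial>M) \<le> (\<integral>x. 1 - x\<^sup>2 / (x\<^sup>2 + y\<^sup>2) \<partial>M)"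
  proof (rule integral_mono)
    show "integrable M (\<lambda>x. 1 / (1 + x\<^sup>2))"
      by (rule integrable_bounded[where B = 1]) (auto simp: divide_le_eq_1 add_pos_nonneg)
    show "integrable M (\<lambda>x. 1 - x\<^sup>2 / (x\<^sup>2 + y\<^sup>2))"
      by (rule integrable_bounded[where B = 1]) (use pos in \<open>auto simp: abs_le_iff divide_le_eq\<close>)
    fix x
    have "1 / (1 + x\<^sup>2) \<le> y\<^sup>2 / (x\<^sup>2 + y\<^sup>2)"
      using assms mult_right_mono[of 1 "y\<^sup>2" "x\<^sup>2"] pos[of x]
      by (simp add: divide_simps add_pos_nonneg) (simp add: algebra_simps add_nonneg_eq_0_iff)
    then show "1 / (1 + x\<^sup>2) \<le> 1 - x\<^sup>2 / (x\<^sup>2 + y\<^sup>2)"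
      using diff_divide_distrib[of "x\<^sup>2 + y\<^sup>2" "x\<^sup>2" "x\<^sup>2 + y\<^sup>2"] assms by simp
  qed
  also have "\<dots> = 1 - (\<integral>x. x\<^sup>2 / (x\<^sup>2 + y\<^sup>2) \<partial>M)"
  proof -
    have "integrable M (\<lambda>x. x\<^sup>2 / (x\<^sup>2 + y\<^sup>2))"
      by (rule integrable_bounded[where B = 1]) (use pos in \<open>auto simp: divide_le_eq\<close>)
    then show ?thesis using prob_space by simp
  qed
  also have "\<dots> = Re (1 - first_resolvent M (\<i> * complex_of_real y))"
    using Re_first_resolvent[of y] assms by simp
  also have "\<dots> \<le> norm (1 - first_resolvent M (\<i> * complex_of_real y))"
    by (rule complex_Re_le_cmod)
  finally show ?thesis .
qed

lemma integral_inverse_pos: "0 < (\<integral>x. 1 / (1 + x\<^sup>2) \<partial>M)"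
proof -
  have "integrable M (\<lambda>x. 1 / (1 + x\<^sup>2))"
    by (rule integrable_bounded[where B = 1]) (auto simp: divide_le_eq_1 add_pos_nonneg)
  then show ?thesis
    using integral_less_AE_space[of "\<lambda>x. 0" "\<lambda>x. 1 / (1 + x\<^sup>2)"] emeasure_space_1
    by (simp add: add_pos_nonneg)
qed

lemma recip_H_eq:
  assumes "Im z \<noteq> 0"
  shows "recip_H M z = z / (1 - first_resolvent M z)"
  using mult_cauchy_G[OF assms, symmetric] assms by (auto simp: recip_H_def)

text \<open>With z = \<i> y and K the first resolvent, H(z) - z = z K / (1 - K). The numerator has
  an expansion by the moment hypothesis, and the denominator is 1 + \<open>iu y\<close> g with g = -
  z K and stays away from 0.\<close>

lemma recip_H_expands:
  assumes "(\<integral>\<^sup>+x. ennreal (x ^ (2 * n)) \<partial>M) < \<infinity>" "n \<ge> 1" "compact S"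
  shows "expands S (2 * n - 1) (\<lambda>s y. recip_H M (\<i> * complex_of_real y) - \<i> * complex_of_real y)"
proof -
  define g where "g = (\<lambda>(s::real) y. - (\<i> * complex_of_real y * first_resolvent M (\<i> * complex_of_real y)))"
  have eq: "1 + iu y * g s y = 1 - first_resolvent M (\<i> * complex_of_real y)" if "y \<ge> 1" for s y
    using iu_mult_iy[of y] that by (simp add: g_def flip: mult.assoc)
  have g: "expands S (2 * n - 1) g"
    unfolding g_def by (intro expands_minus expands_of_moment_finite assms)
  have "expands S (Suc (2 * n - 1)) (\<lambda>s y. 1 / (1 + iu y * g s y))"
    using norm_one_minus_first_resolvent_ge
    by (intro expands_inverse[OF g assms(3) integral_inverse_pos]) (simp add: eq)
  then have "expands S (2 * n - 1) (\<lambda>s y. - (g s y * (1 / (1 + iu y * g s y))))"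
    by (intro expands_minus expands_mult[OF g _ assms(3)] assms(3)) (rule expands_mono, auto)
  then show ?thesis
  proof (rule expands_cong)
    fix s y :: real assume y: "y \<ge> 1"
    have "1 - first_resolvent M (\<i> * complex_of_real y) \<noteq> 0"
      using norm_one_minus_first_resolvent_ge[OF y] integral_inverse_pos by auto
    then show "recip_H M (\<i> * complex_of_real y) - \<i> * complex_of_real y = - (g s y * (1 / (1 + iu y * g s y)))"
      unfolding eq[OF y] using y by (simp add: recip_H_eq g_def field_simps)
  qed
qed

text \<open>The first resolvent equals 1 - z / H(z), and inverting H regains the one order lost in
  the passage to H(z) - z.\<close>

lemma moment_finite_of_recip_H_expands:
  assumes exp: "expands {t} (2 * n - 1) (\<lambda>s y. recip_H M (\<i> * complex_of_real y) - \<i> * complex_of_real y)"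
    and "n \<ge> 1"
    and Im: "\<And>y. y \<ge> 1 \<Longrightarrow> y \<le> Im (recip_H M (\<i> * complex_of_real y))"
  shows "(\<integral>\<^sup>+x. ennreal (x ^ (2 * n)) \<partial>M) < \<infinity>"
proof (rule moment_finite_of_expands)
  have *: "expands {t} (2 * n) (\<lambda>s y. \<i> * complex_of_real y / recip_H M (\<i> * complex_of_real y))"
    using expands_inverse_shift(1)[OF exp] Im assms(2) by simp
  have "expands {t} (2 * n) (\<lambda>s y. poly [:1:] (iu y) + - (\<i> * complex_of_real y / recip_H M (\<i> * complex_of_real y)))"
    by (intro expands_add expands_poly expands_minus *) auto
  then show "expands {t} (2 * n) (\<lambda>s y. first_resolvent M (\<i> * complex_of_real y))"
  proof (rule expands_cong)
    fix s y :: real assume "y \<ge> 1"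
    then show "first_resolvent M (\<i> * complex_of_real y) =
      poly [:1:] (iu y) + - (\<i> * complex_of_real y / recip_H M (\<i> * complex_of_real y))"
      by (simp add: recip_H_eq)
  qed
qed simp

end

section \<open>Monotone semigroups\<close>

locale monotone_flow =
  fixes \<mu> :: "real \<Rightarrow> real measure" and \<gamma> :: real and \<tau> :: "real measure"
  assumes distr: "\<And>t. t \<ge> 0 \<Longrightarrow> real_distribution (\<mu> t)"
    and weak: "weakly_continuous_family \<mu>"
    and tau: "finite_borel_measure \<tau>"
    and init: "\<And>z. Im z \<noteq> 0 \<Longrightarrow> recip_H (\<mu> 0) z = z"
    and deriv: "\<And>t z. t \<ge> 0 \<Longrightarrow> Im z \<noteq> 0 \<Longrightarrow>
      ((\<lambda>s. recip_H (\<mu> s) z) has_vector_derivative gen_A \<gamma> \<tau> (recip_H (\<mu> t) z)) (at t within {0..})"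
begin

sublocale tau: finite_borel_measure \<tau> by (rule tau)

definition h :: "real \<Rightarrow> real \<Rightarrow> complex" where
  "h s y = recip_H (\<mu> s) (\<i> * complex_of_real y)"

lemma h_deriv: "t \<ge> 0 \<Longrightarrow> y > 0 \<Longrightarrow>
    ((\<lambda>s. h s y) has_vector_derivative gen_A \<gamma> \<tau> (h t y)) (at t within {0..})"
  unfolding h_def by (rule deriv) auto

lemma h_continuous: "y > 0 \<Longrightarrow> continuous_on {0..} (\<lambda>s. h s y)"
  unfolding continuous_on_eq_continuous_within
  by (auto intro: has_vector_derivative_continuous h_deriv)

lemma h_integral:
  assumes "t \<ge> 0" "y > 0"
  shows "((\<lambda>s. gen_A \<gamma> \<tau> (h s y)) has_integral h t y - \<i> * complex_of_real y) {0..t}"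
proof -
  have "((\<lambda>s. gen_A \<gamma> \<tau> (h s y)) has_integral h t y - h 0 y) {0..t}"
    by (rule fundamental_theorem_of_calculus)
      (use assms in \<open>auto intro!: has_vector_derivative_within_subset[OF h_deriv]\<close>)
  moreover have "h 0 y = \<i> * complex_of_real y"
    unfolding h_def by (rule init) (use assms in simp)
  ultimately show ?thesis by simp
qed

lemma Im_h_pos: "t \<ge> 0 \<Longrightarrow> y > 0 \<Longrightarrow> Im (h t y) > 0"
  unfolding h_def by (rule real_distribution.Im_recip_H_pos[OF distr]) auto

lemma Im_h_integral:
  assumes "t \<ge> 0" "y > 0"
  shows "((\<lambda>s. Im (gen_A \<gamma> \<tau> (h s y))) has_integral Im (h t y) - y) {0..t}"
  using has_integral_linear[OF h_integral[OF assms] bounded_linear_Im] by (simp add: o_def)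

text \<open>The flow stays in the upper half-plane, where Im A is nonnegative, so the imaginary part
  cannot fall below its initial value y.\<close>

lemma Im_h_ge:
  assumes "t \<ge> 0" "y > 0"
  shows "y \<le> Im (h t y)"
proof -
  have "0 \<le> Im (h t y) - y"
  proof (rule has_integral_nonneg[OF Im_h_integral[OF assms]])
    fix s assume "s \<in> {0..t}"
    then have "Im (h s y) > 0" using Im_h_pos assms by auto
    then show "0 \<le> Im (gen_A \<gamma> \<tau> (h s y))"
      by (subst tau.Im_gen_A(2)) (auto intro!: mult_nonneg_nonneg Bochner_Integration.integral_nonneg)
  qed
  then show ?thesis by simp
qed

lemma flow_expands:
  assumes fin: "(\<integral>\<^sup>+x. ennreal (x ^ (2 * k)) \<partial>\<tau>) < \<infinity>" and k: "k \<ge> 1"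
  shows "expands {0..T} (2 * k - 1) (\<lambda>s y. h s y - \<i> * complex_of_real y)"
proof -
  obtain P where P: "real_poly P"
    "\<And>w. Im w \<noteq> 0 \<Longrightarrow> gen_A \<gamma> \<tau> w = poly P (1 / w) + ((1 / w) ^ (2 * k - 1) *
      first_resolvent (weighted k \<tau>) w + (1 / w) ^ (2 * k) * resolvent (weighted k \<tau>) w)"
    using tau.gen_A_expansion[OF fin k, of \<gamma>] by metis
  show ?thesis
    by (rule expands_of_flow[OF _ _ P(1) tau.gen_A_approx[OF fin k P(2)]])
      (auto intro!: Im_h_ge h_integral)
qed

lemma moment_finite_of_generator:
  assumes fin: "(\<integral>\<^sup>+x. ennreal (x ^ (2 * n)) \<partial>\<tau>) < \<infinity>" and "n \<ge> 1" "t > 0"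
  shows "(\<integral>\<^sup>+x. ennreal (x ^ (2 * n)) \<partial>\<mu> t) < \<infinity>"
proof -
  interpret real_distribution "\<mu> t" using distr assms by simp
  have "expands {t} (2 * n - 1) (\<lambda>s y. h s y - \<i> * complex_of_real y)"
    using flow_expands[OF assms(1,2), of t] by (rule expands_subset) (use assms in auto)
  then have "expands {t} (2 * n - 1) (\<lambda>s y. recip_H (\<mu> t) (\<i> * complex_of_real y) - \<i> * complex_of_real y)"
    by (rule expands_cong) (simp add: h_def)
  then show ?thesis
    by (rule moment_finite_of_recip_H_expands) (use assms Im_h_ge[of t] in \<open>auto simp: h_def\<close>)
qed

text \<open>Here weak continuity enters: \<open>y \<bar>G(\<i> y)\<bar>\<close> is at least the integral of \<open>1 / (1 + x\<^sup>2)\<close>, which is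
  bounded away from \<open>0\<close> on compact time intervals.\<close>
lemma h_linear_bound:
  assumes "T \<ge> 0"
  obtains L where "L \<ge> 1" "\<And>s y. s \<in> {0..T} \<Longrightarrow> y \<ge> 1 \<Longrightarrow> norm (h s y) \<le> L * y"
proof -
  define c where "c s = (\<integral>x. 1 / (1 + x\<^sup>2) \<partial>\<mu> s)" for s
  have "continuous_on UNIV (\<lambda>x::real. 1 / (1 + x\<^sup>2)) \<and> bounded (range (\<lambda>x::real. 1 / (1 + x\<^sup>2)))"
    by (auto intro!: continuous_intros boundedI[where B = 1] simp: add_nonneg_eq_0_iff divide_le_eq_1 add_pos_nonneg)
  then have "continuous_on {0..} c"
    using weak unfolding weakly_continuous_family_def c_def by blast
  then have "continuous_on {0..T} c" by (rule continuous_on_subset) auto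
  then obtain s0 where s0: "s0 \<in> {0..T}" "\<And>s. s \<in> {0..T} \<Longrightarrow> c s0 \<le> c s"
    using continuous_attains_inf[of "{0..T}" c] assms by auto
  have c0: "c s0 > 0"
    unfolding c_def using s0 by (intro real_distribution.integral_inverse_pos distr) auto
  \<comment> \<open>The maximum with 1 provides \<open>L \<ge> 1\<close>.\<close>
  have "norm (h s y) \<le> max 1 (1 / c s0) * y" if sy: "s \<in> {0..T}" "y \<ge> 1" for s y
  proof -
    interpret real_distribution "\<mu> s" using distr sy by simp
    have ge: "c s0 \<le> norm (1 - first_resolvent (\<mu> s) (\<i> * complex_of_real y))"
      using norm_one_minus_first_resolvent_ge[OF sy(2)] s0(2)[OF sy(1)] by (simp add: c_def)
    have "norm (h s y) = y / norm (1 - first_resolvent (\<mu> s) (\<i> * complex_of_real y))"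
      using sy by (simp add: h_def recip_H_eq norm_divide norm_mult)
    also have "\<dots> \<le> y / c s0"
      using ge c0 sy by (intro divide_left_mono mult_pos_pos) auto
    also have "\<dots> \<le> max 1 (1 / c s0) * y"
      using mult_right_mono[of "1 / c s0" "max 1 (1 / c s0)" y] sy by simp
    finally show ?thesis .
  qed
  then show ?thesis using that[of "max 1 (1 / c s0)"] by simp
qed

text \<open>A first-order real expansion gives Im h(T, y) - y = O(1 / y). This difference is the
  time integral of Im A, which is at least y times the integral of (1 + x^2) / (|x| + L y)^2 against
  \<tau>. Hence y^2 times the latter integral is bounded, and letting y tend to infinity gives the
  moment by Fatou's lemma.\<close>

lemma generator_second_moment:
  assumes fin: "(\<integral>\<^sup>+x. ennreal (x\<^sup>2) \<partial>\<mu> T) < \<infinity>" and T: "T > 0"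
  shows "(\<integral>\<^sup>+x. ennreal (x\<^sup>2) \<partial>\<tau>) < \<infinity>"
proof -
  interpret real_distribution "\<mu> T" using distr T by simp
  have "expands {T} (2 * 1 - 1) (\<lambda>s y. recip_H (\<mu> T) (\<i> * complex_of_real y) - \<i> * complex_of_real y)"
    by (rule recip_H_expands) (use fin in auto)
  then have "expands {T} 1 (\<lambda>s y. h T y - \<i> * complex_of_real y)"
    by (simp add: h_def)
  then obtain p C where p: "poly_path {T} p" "\<And>s y. s \<in> {T} \<Longrightarrow> y \<ge> 1 \<Longrightarrow>
      norm (h T y - \<i> * complex_of_real y - poly (p s) (iu y)) \<le> C / y ^ 1"
    by (rule expandsE, blast)
  obtain a p' where p': "p T = pCons a p'" by (cases "p T") auto
  have a: "a \<in> \<real>" using p(1) p' by (auto simp: poly_path_def)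
  have "real_poly p'" using p(1) p' by (auto simp: poly_path_def)
  then obtain B where B: "\<And>s v. s \<in> {0::real} \<Longrightarrow> norm v \<le> 1 \<Longrightarrow> norm (poly p' v) \<le> B"
    using poly_path_bounded[OF poly_path_const compact_sing] by metis
  define D where "D = B + C"
  have D: "Im (h T y) - y \<le> D / y" if y: "y \<ge> 1" for y
  proof -
    have "norm (iu y * poly p' (iu y)) \<le> (1 / y) * B"
      unfolding norm_mult using y B[of 0 "iu y"] by (intro mult_mono) (auto simp: norm_iu)
    then have "Im (iu y * poly p' (iu y)) \<le> B / y" using abs_Im_le_cmod[of "iu y * poly p' (iu y)"] by simp
    \<comment> \<open>Reality of the constant term is what makes Im h - y decay.\<close>
    moreover have "Im (poly (p T) (iu y)) = Im (iu y * poly p' (iu y))"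
      using a by (simp add: p' complex_is_Real_iff)
    moreover have "Im (h T y - \<i> * complex_of_real y - poly (p T) (iu y)) \<le> C / y"
      using p(2)[of T y] y abs_Im_le_cmod[of "h T y - \<i> * complex_of_real y - poly (p T) (iu y)"] by simp
    ultimately show ?thesis by (simp add: D_def add_divide_distrib)
  qed
  obtain L where L: "L \<ge> 1" "\<And>s y. s \<in> {0..T} \<Longrightarrow> y \<ge> 1 \<Longrightarrow> norm (h s y) \<le> L * y"
    using h_linear_bound[of T] T by auto
  have "(\<integral>\<^sup>+x. ennreal ((1 + x\<^sup>2) / L\<^sup>2) \<partial>\<tau>) \<le> ennreal (D / T)"
  proof (rule nn_integral_le_of_tendsto)
    fix x
    show "(\<lambda>i. ennreal ((1 + x\<^sup>2) * real (Suc i) ^ 2 / (\<bar>x\<bar> + L * real (Suc i))\<^sup>2)) \<longlonglongrightarrow> ennreal ((1 + x\<^sup>2) / L\<^sup>2)"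
    proof (rule tendsto_ennrealI)
      have "(\<lambda>i. (1 + x\<^sup>2) / (\<bar>x\<bar> / real (Suc i) + L)\<^sup>2) \<longlonglongrightarrow> (1 + x\<^sup>2) / (0 + L)\<^sup>2"
      proof (intro tendsto_intros)
        show "(\<lambda>i. \<bar>x\<bar> / real (Suc i)) \<longlonglongrightarrow> 0" by real_asymp
      qed (use L in auto)
      moreover have "(1 + x\<^sup>2) / (\<bar>x\<bar> / real (Suc i) + L)\<^sup>2 = (1 + x\<^sup>2) * real (Suc i) ^ 2 / (\<bar>x\<bar> + L * real (Suc i))\<^sup>2" for i
      proof -
        have "\<bar>x\<bar> / real (Suc i) + L = (\<bar>x\<bar> + L * real (Suc i)) / real (Suc i)"
          by (simp add: field_simps)
        then show ?thesis by (simp only: power_divide divide_divide_eq_right)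
      qed
      ultimately show "(\<lambda>i. (1 + x\<^sup>2) * real (Suc i) ^ 2 / (\<bar>x\<bar> + L * real (Suc i))\<^sup>2) \<longlonglongrightarrow> (1 + x\<^sup>2) / L\<^sup>2"
        by simp
    qed
  next
    fix i
    define y where "y = real (Suc i)"
    have y: "y \<ge> 1" by (simp add: y_def)
    \<comment> \<open>The linear bound on h makes this a minorant of the kernel of Im A that does
      not depend on the time s.\<close>
    define g where "g x = (1 + x\<^sup>2) / (\<bar>x\<bar> + L * y)\<^sup>2" for x
    have Ly: "L * y \<ge> 1" using L y by (simp add: mult_ge1_I)
    have int_g: "integrable \<tau> g"
    proof (rule tau.integrable_bounded[where B = 1])
      fix x :: real
      have "1 + x\<^sup>2 \<le> (\<bar>x\<bar> + L * y)\<^sup>2"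
        using one_le_power[OF Ly, of 2] Ly by (simp add: power2_sum add_increasing2)
      then show "norm (g x) \<le> 1" unfolding g_def using Ly by (simp add: divide_le_eq_1)
    qed (auto simp: g_def[abs_def])
    define J where "J = (\<integral>x. g x \<partial>\<tau>)"
    have J: "J \<ge> 0" unfolding J_def by (rule Bochner_Integration.integral_nonneg) (simp add: g_def)
    have const: "((\<lambda>s. y * J) has_integral (y * J) * T) {0..T}"
      using has_integral_const_real[of "y * J" 0 T] T by (simp add: mult.commute)
    \<comment> \<open>The factor Im h is at least y, and the kernel integral is at least
      \<open>J\<close>.\<close>
    have le: "y * J \<le> Im (gen_A \<gamma> \<tau> (h s y))" if s: "s \<in> {0..T}" for s
    proof -
      have Im: "Im (h s y) \<ge> y" using s y by (intro Im_h_ge) auto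
      have "J \<le> (\<integral>x. (1 + x\<^sup>2) / (cmod (complex_of_real x - h s y))\<^sup>2 \<partial>\<tau>)"
        unfolding J_def
      proof (rule integral_mono[OF int_g])
        show "integrable \<tau> (\<lambda>x. (1 + x\<^sup>2) / (cmod (complex_of_real x - h s y))\<^sup>2)"
          by (rule tau.Im_gen_A(1)) (use Im y in auto)
        fix x
        have "cmod (complex_of_real x - h s y) \<le> \<bar>x\<bar> + L * y"
          using norm_triangle_ineq4[of "complex_of_real x" "h s y"] L(2)[OF s y] by simp
        moreover have "complex_of_real x \<noteq> h s y" using Im y by (intro of_real_neq_nonreal) simp
        ultimately show "g x \<le> (1 + x\<^sup>2) / (cmod (complex_of_real x - h s y))\<^sup>2"
          unfolding g_def using Ly by (intro divide_left_mono power_mono mult_pos_pos) auto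
      qed
      then show ?thesis
        using Im y J by (subst tau.Im_gen_A(2)) (auto intro!: mult_mono)
    qed
    have "(y * J) * T \<le> Im (h T y) - y"
      by (rule has_integral_le[OF const Im_h_integral le]) (use T y in auto)
    then have "(y * J) * T \<le> D / y" using D[OF y] by linarith
    then have *: "y\<^sup>2 * J \<le> D / T" using y T by (simp add: field_simps power2_eq_square)
    have "(\<integral>\<^sup>+x. ennreal ((1 + x\<^sup>2) * y ^ 2 / (\<bar>x\<bar> + L * y)\<^sup>2) \<partial>\<tau>) = (\<integral>\<^sup>+x. ennreal (y\<^sup>2 * g x) \<partial>\<tau>)"
      by (simp add: g_def mult.commute)
    also have "\<dots> = ennreal (\<integral>x. y\<^sup>2 * g x \<partial>\<tau>)"
      by (intro nn_integral_eq_integral integrable_mult_right int_g) (simp add: g_def)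
    also have "\<dots> \<le> ennreal (D / T)"
      using * by (intro ennreal_leI) (simp add: J_def)
    finally show "(\<integral>\<^sup>+x. ennreal ((1 + x\<^sup>2) * real (Suc i) ^ 2 / (\<bar>x\<bar> + L * real (Suc i))\<^sup>2) \<partial>\<tau>) \<le> ennreal (D / T)"
      by (simp add: y_def)
  qed auto
  also have "\<dots> < \<infinity>" by simp
  finally have "(\<integral>\<^sup>+x. ennreal ((1 + x\<^sup>2) / L\<^sup>2) \<partial>\<tau>) < \<infinity>" .
  then have "ennreal (L\<^sup>2) * (\<integral>\<^sup>+x. ennreal ((1 + x\<^sup>2) / L\<^sup>2) \<partial>\<tau>) < \<infinity>"
    by (simp add: ennreal_mult_less_top)
  moreover have "(\<integral>\<^sup>+x. ennreal (x\<^sup>2) \<partial>\<tau>) \<le> (\<integral>\<^sup>+x. ennreal (L\<^sup>2) * ennreal ((1 + x\<^sup>2) / L\<^sup>2) \<partial>\<tau>)"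
    by (rule nn_integral_mono) (use L in \<open>auto simp: ennreal_mult[symmetric] intro!: ennreal_leI\<close>)
  ultimately show ?thesis
    by (simp add: nn_integral_cmult order_le_less_trans)
qed

end

section \<open>Perturbation of the first resolvent near the imaginary axis\<close>

context finite_borel_measure
begin

text \<open>The integral of the modulus of the kernel of \<open>first_resolvent\<close> at \<i>
  y.\<close>

definition tail :: "real \<Rightarrow> real" where
  "tail y = (\<integral>x. \<bar>x\<bar> / sqrt (x\<^sup>2 + y\<^sup>2) \<partial>M)"

lemma cmod_of_real_minus_iy: "cmod (complex_of_real x - \<i> * complex_of_real y) = sqrt (x\<^sup>2 + y\<^sup>2)"
  by (simp add: cmod_def)

lemma tail_kernel_bounds:
  assumes "y > 0"
  shows "0 \<le> \<bar>x\<bar> / sqrt (x\<^sup>2 + y\<^sup>2)" "\<bar>x\<bar> / sqrt (x\<^sup>2 + y\<^sup>2) \<le> 1" "y \<le> sqrt (x\<^sup>2 + y\<^sup>2)"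
  using assms by (auto intro!: real_le_rsqrt simp: divide_le_eq_1 add_nonneg_pos)

lemma integrable_tail: "y > 0 \<Longrightarrow> integrable M (\<lambda>x. \<bar>x\<bar> / sqrt (x\<^sup>2 + y\<^sup>2))"
  by (rule integrable_bounded[where B = 1]) (use tail_kernel_bounds[of y] in auto)

lemma tail_bounds:
  assumes "y > 0"
  shows "0 \<le> tail y" "tail y \<le> measure M UNIV"
proof -
  show "0 \<le> tail y"
    unfolding tail_def by (rule Bochner_Integration.integral_nonneg) (use tail_kernel_bounds assms in auto)
  have "tail y \<le> (\<integral>x. 1 \<partial>M)"
    unfolding tail_def by (intro integral_mono integrable_tail tail_kernel_bounds assms) auto
  then show "tail y \<le> measure M UNIV" by simp
qed

lemma norm_first_resolvent_le_tail:
  assumes "y > 0"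
  shows "norm (first_resolvent M (\<i> * complex_of_real y)) \<le> tail y"
  unfolding first_resolvent_def tail_def
  by (rule order_trans[OF integral_norm_bound]) (simp add: norm_divide cmod_of_real_minus_iy)

text \<open>The arithmetic-geometric inequality makes the linear quantity \<open>tail\<close> absorbable into the
  quadratic one, up to the order that is aimed for.\<close>
lemma tail_le:
  assumes "y > 0" "\<delta> > 0"
  shows "tail y / y \<le> \<delta> * Re (first_resolvent M (\<i> * complex_of_real y)) + measure M UNIV / (4 * \<delta> * y\<^sup>2)"
proof -
  have "tail y / y = (\<integral>x. \<bar>x\<bar> / sqrt (x\<^sup>2 + y\<^sup>2) / y \<partial>M)"
    unfolding tail_def by (rule integral_divide_zero[symmetric])
  also have "\<dots> \<le> (\<integral>x. \<delta> * (x\<^sup>2 / (x\<^sup>2 + y\<^sup>2)) + 1 / (4 * \<delta> * y\<^sup>2) \<partial>M)"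
  proof (rule integral_mono)
    have "integrable M (\<lambda>x. x\<^sup>2 / (x\<^sup>2 + y\<^sup>2))"
      by (rule integrable_bounded[where B = 1]) (use assms in \<open>auto simp: divide_le_eq add_nonneg_pos\<close>)
    then show "integrable M (\<lambda>x. \<delta> * (x\<^sup>2 / (x\<^sup>2 + y\<^sup>2)) + 1 / (4 * \<delta> * y\<^sup>2))"
      by (intro Bochner_Integration.integrable_add integrable_mult_right) auto
    show "integrable M (\<lambda>x. \<bar>x\<bar> / sqrt (x\<^sup>2 + y\<^sup>2) / y)"
      by (rule Bochner_Integration.integrable_divide_zero) (use integrable_tail[OF assms(1)] in auto)
    fix x :: real
    define a where "a = \<bar>x\<bar> / sqrt (x\<^sup>2 + y\<^sup>2)"
    have "\<delta> * a\<^sup>2 = \<delta> * (x\<^sup>2 / (x\<^sup>2 + y\<^sup>2))" by (simp add: a_def power_divide)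
    \<comment> \<open>The centre of the square is chosen so that its mixed term is a / y.\<close>
    moreover have "0 \<le> \<delta> * (a - 1 / (2 * \<delta> * y))\<^sup>2" using assms by simp
    moreover have "\<delta> * (a - 1 / (2 * \<delta> * y))\<^sup>2 = \<delta> * a\<^sup>2 + 1 / (4 * \<delta> * y\<^sup>2) - a / y"
      using assms by (simp add: power2_eq_square field_simps)
    ultimately show "\<bar>x\<bar> / sqrt (x\<^sup>2 + y\<^sup>2) / y \<le> \<delta> * (x\<^sup>2 / (x\<^sup>2 + y\<^sup>2)) + 1 / (4 * \<delta> * y\<^sup>2)"
      unfolding a_def[symmetric] by linarith
  qed
  also have "\<dots> = \<delta> * (\<integral>x. x\<^sup>2 / (x\<^sup>2 + y\<^sup>2) \<partial>M) + measure M UNIV / (4 * \<delta> * y\<^sup>2)"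
  proof -
    have "integrable M (\<lambda>x. \<delta> * (x\<^sup>2 / (x\<^sup>2 + y\<^sup>2)))"
      by (rule integrable_mult_right, rule integrable_bounded[where B = 1])
        (use assms in \<open>auto simp: divide_le_eq add_nonneg_pos\<close>)
    then show ?thesis
      by (subst Bochner_Integration.integral_add) (simp_all only: integral_mult_right_zero, simp_all)
  qed
  finally show ?thesis using Re_first_resolvent[OF assms(1)] by simp
qed

text \<open>The kernels differ by x (w - \<i> y) / ((x - w) (x - \<i> y)). Since |x - \<i> y| \<le>
  (1 + D) |x - w|, both denominators can be taken at \<i> y; one of them yields 1 / y and the other
  leaves the kernel of \<open>tail\<close>.\<close>

lemma first_resolvent_perturbation:
  assumes y: "y \<ge> 1" "y \<le> Im w" and w: "norm (w - \<i> * complex_of_real y) \<le> D"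
  shows "norm (first_resolvent M w - first_resolvent M (\<i> * complex_of_real y)) \<le> D * (1 + D) * (tail y / y)"
proof -
  have D: "D \<ge> 0" using w norm_ge_zero order_trans by blast
  have Im: "Im w \<noteq> 0" "Im (\<i> * complex_of_real y) \<noteq> 0" using y by auto
  have "first_resolvent M w - first_resolvent M (\<i> * complex_of_real y) =
    (\<integral>x. complex_of_real x / (complex_of_real x - w) -
       complex_of_real x / (complex_of_real x - \<i> * complex_of_real y) \<partial>M)"
    unfolding first_resolvent_def
    by (rule Bochner_Integration.integral_diff[symmetric]) (intro integrable_first_resolvent Im)+
  also have "norm \<dots> \<le> (\<integral>x. norm (complex_of_real x / (complex_of_real x - w) -
       complex_of_real x / (complex_of_real x - \<i> * complex_of_real y)) \<partial>M)"
    by (rule integral_norm_bound)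
  also have "\<dots> \<le> (\<integral>x. D * (1 + D) / y * (\<bar>x\<bar> / sqrt (x\<^sup>2 + y\<^sup>2)) \<partial>M)"
  proof (rule integral_mono)
    show "integrable M (\<lambda>x. norm (complex_of_real x / (complex_of_real x - w) -
       complex_of_real x / (complex_of_real x - \<i> * complex_of_real y)))"
      by (intro integrable_norm Bochner_Integration.integrable_diff integrable_first_resolvent Im)
    show "integrable M (\<lambda>x. D * (1 + D) / y * (\<bar>x\<bar> / sqrt (x\<^sup>2 + y\<^sup>2)))"
      using y by (intro integrable_mult_right integrable_tail) auto
    fix x :: real
    define a where "a = complex_of_real x - w"
    define b where "b = complex_of_real x - \<i> * complex_of_real y"
    have a: "1 \<le> norm a" using norm_of_real_diff_ge[of w x] y by (simp add: a_def)
    have nb: "norm b = sqrt (x\<^sup>2 + y\<^sup>2)" by (simp add: b_def cmod_of_real_minus_iy)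
    have le_b: "y \<le> norm b" unfolding nb using tail_kernel_bounds(3) y by simp
    have ab: "norm b \<le> (1 + D) * norm a"
    proof -
      have "b = a + (w - \<i> * complex_of_real y)" by (simp add: a_def b_def)
      then have "norm b \<le> norm a + D"
        using w norm_triangle_ineq[of a "w - \<i> * complex_of_real y"] by simp
      \<comment> \<open>Here \<open>norm a\<close> is at least 1, because Im w \<ge> y \<ge>
        1.\<close>
      also have "\<dots> \<le> norm a + D * norm a" using a D mult_left_mono[of 1 "norm a" D] by simp
      finally show ?thesis by (simp add: algebra_simps)
    qed
    have ne: "a \<noteq> 0" "b \<noteq> 0" using a le_b y by auto
    have "complex_of_real x / a - complex_of_real x / b = complex_of_real x * (w - \<i> * complex_of_real y) / (a * b)"
      using ne by (simp add: field_simps) (simp add: a_def b_def algebra_simps)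
    then have "norm (complex_of_real x / a - complex_of_real x / b) \<le> \<bar>x\<bar> * D / (norm a * norm b)"
      using w by (simp add: norm_divide norm_mult divide_right_mono mult_left_mono)
    also have "\<dots> = \<bar>x\<bar> * D / norm b * (1 / norm a)" by simp
    also have "\<dots> \<le> \<bar>x\<bar> * D / norm b * ((1 + D) / norm b)"
      using ab ne D by (intro mult_left_mono) (auto simp: divide_simps)
    also have "\<dots> \<le> \<bar>x\<bar> * D / norm b * ((1 + D) / y)"
      using le_b y D by (intro mult_left_mono divide_left_mono mult_pos_pos) auto
    finally show "norm (complex_of_real x / (complex_of_real x - w) -
       complex_of_real x / (complex_of_real x - \<i> * complex_of_real y)) \<le> D * (1 + D) / y * (\<bar>x\<bar> / sqrt (x\<^sup>2 + y\<^sup>2))"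
      unfolding a_def[symmetric] b_def[symmetric] nb[symmetric] by (simp add: mult_ac)
  qed
  also have "\<dots> = D * (1 + D) * (tail y / y)"
    unfolding integral_mult_right_zero by (simp add: tail_def)
  finally show ?thesis .
qed

text \<open>After multiplication by y^m the two prefactors are m-th powers of points z and u of the
  closed unit disc at distance at most D / y, so they differ by at most m D / y. Every error keeps a
  factor \<open>tail y / y\<close>, which can later be absorbed.\<close>

lemma scaled_first_resolvent_perturbation:
  assumes y: "y \<ge> 1" "y \<le> Im w" and w: "norm (w - \<i> * complex_of_real y) \<le> D"
  shows "norm ((1 / w) ^ m * first_resolvent M w - iu y ^ m * first_resolvent M (\<i> * complex_of_real y))
    \<le> (D * (1 + D) + real m * D) * (tail y / y) / y ^ m"
proof -
  define z where "z = complex_of_real y / w"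
  define u where "u = complex_of_real y * iu y"
  define K where "K = first_resolvent M (\<i> * complex_of_real y)"
  define E where "E = first_resolvent M w - K"
  have wy: "y \<le> norm w" using y abs_Im_le_cmod[of w] by linarith
  have w0: "w \<noteq> 0" using wy y by auto
  have z: "norm z \<le> 1" using wy y w0 by (simp add: z_def norm_divide divide_le_eq)
  have u: "norm u \<le> 1" using y by (simp add: u_def norm_mult norm_iu)
  have "z - u = (\<i> * complex_of_real y - w) / (\<i> * w)"
    using y w0 by (simp add: z_def u_def iu_def field_simps)
  then have "norm (z - u) = norm (w - \<i> * complex_of_real y) / norm w"
    by (simp add: norm_divide norm_mult norm_minus_commute)
  also have "\<dots> \<le> D / y" using w wy y order_trans[OF norm_ge_zero w] by (intro frac_le) auto
  finally have zu: "norm (z ^ m - u ^ m) \<le> real m * (D / y)"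
    using norm_power_diff[OF z u, of m] mult_left_mono[of "norm (z - u)" "D / y" "real m"] by linarith
  have K: "norm K \<le> tail y" using norm_first_resolvent_le_tail y by (simp add: K_def)
  have E: "norm E \<le> D * (1 + D) * (tail y / y)"
    unfolding E_def K_def by (rule first_resolvent_perturbation[OF assms])
  have "norm (z ^ m * E + (z ^ m - u ^ m) * K) \<le> 1 * (D * (1 + D) * (tail y / y)) + real m * (D / y) * tail y"
  proof (rule norm_triangle_le, rule add_mono)
    show "norm (z ^ m * E) \<le> 1 * (D * (1 + D) * (tail y / y))"
      unfolding norm_mult norm_power by (rule mult_mono[OF power_le_one[OF norm_ge_zero z] E]) auto
    show "norm ((z ^ m - u ^ m) * K) \<le> real m * (D / y) * tail y"
      unfolding norm_mult by (rule mult_mono[OF zu K]) (use order_trans[OF norm_ge_zero zu] in auto)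
  qed
  also have "\<dots> = (D * (1 + D) + real m * D) * (tail y / y)"
    by (simp add: algebra_simps add_divide_distrib)
  finally have bound: "norm (z ^ m * E + (z ^ m - u ^ m) * K) / y ^ m \<le> (D * (1 + D) + real m * D) * (tail y / y) / y ^ m"
    using y by (intro divide_right_mono) auto
  have scale: "complex_of_real y ^ m * ((1 / w) ^ m * first_resolvent M w - iu y ^ m * K) = z ^ m * E + (z ^ m - u ^ m) * K"
  proof -
    have "complex_of_real y ^ m * (1 / w) ^ m = z ^ m" "complex_of_real y ^ m * iu y ^ m = u ^ m"
      by (simp_all add: z_def u_def power_mult_distrib power_divide)
    then have "complex_of_real y ^ m * ((1 / w) ^ m * first_resolvent M w - iu y ^ m * K) =
       z ^ m * first_resolvent M w - u ^ m * K"
      by (simp only: right_diff_distrib mult.assoc[symmetric])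
    then show ?thesis by (simp add: E_def algebra_simps)
  qed
  have "norm (z ^ m * E + (z ^ m - u ^ m) * K) / y ^ m = norm ((1 / w) ^ m * first_resolvent M w - iu y ^ m * K)"
    unfolding scale[symmetric] norm_mult norm_power using y by simp
  then show ?thesis using bound by (simp add: K_def)
qed

end

section \<open>Induction for the moments of the generator measure\<close>

context monotone_flow
begin

text \<open>Up to the order of the hypothesis, the integral over \<open>{0..T}\<close> of the remainder of \<open>A\<close> along the flow
  is \<open>T\<close> times its value at \<open>\<i> y\<close>.\<close>
lemma generator_next_moment:
  assumes T: "T > 0" and k: "k \<ge> 1"
    and fin: "(\<integral>\<^sup>+x. ennreal (x ^ (2 * k)) \<partial>\<tau>) < \<infinity>"
    and exp: "expands {T} (2 * k + 1) (\<lambda>s y. h T y - \<i> * complex_of_real y)"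
  shows "(\<integral>\<^sup>+x. ennreal (x ^ (2 * Suc k)) \<partial>\<tau>) < \<infinity>"
proof -
  \<comment> \<open>The remainder of A has order m, and the hypothesis on h has order m + 2.\<close>
  define m where "m = 2 * k - 1"
  have m: "2 * k = Suc m" "2 * k + 1 = m + 2" using k by (auto simp: m_def)
  interpret W: finite_borel_measure "weighted k \<tau>"
    by (rule tau.weighted_finite_borel_measure[OF fin])
  define K where "K y = first_resolvent (weighted k \<tau>) (\<i> * complex_of_real y)" for y
  define M0 where "M0 = measure (weighted k \<tau>) UNIV"
  have M0: "M0 \<ge> 0" by (simp add: M0_def)
  obtain P where P0: "real_poly P" "\<And>w. Im w \<noteq> 0 \<Longrightarrow> gen_A \<gamma> \<tau> w = poly P (1 / w) + ((1 / w) ^ (2 * k - 1) *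
      first_resolvent (weighted k \<tau>) w + (1 / w) ^ (2 * k) * resolvent (weighted k \<tau>) w)"
    using tau.gen_A_expansion[OF fin k, of \<gamma>] by metis
  have P: "gen_A \<gamma> \<tau> w = poly P (1 / w) + ((1 / w) ^ m *
      first_resolvent (weighted k \<tau>) w + (1 / w) ^ Suc m * resolvent (weighted k \<tau>) w)"
    if "Im w \<noteq> 0" for w
    using P0(2)[OF that] by (simp only: m_def m(1)[unfolded m_def, symmetric])
  have flow: "expands {0..T} m (\<lambda>s y. h s y - \<i> * complex_of_real y)"
    unfolding m_def by (rule flow_expands[OF fin k])
  obtain D where D: "D \<ge> 0" "\<And>s y. s \<in> {0..T} \<Longrightarrow> y \<ge> 1 \<Longrightarrow> norm (h s y - \<i> * complex_of_real y) \<le> D"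
    using expands_bounded[OF flow compact_Icc] by metis
  have Im: "y \<le> Im (h s y)" if "s \<in> {0..T}" "y \<ge> 1" for s y
    using Im_h_ge[of s y] that by simp
  define F where "F t y = integral {0..t} (\<lambda>s. poly P (1 / h s y))" for t y
  have F: "((\<lambda>s. poly P (1 / h s y)) has_integral F t y) {0..t}" if "t \<in> {0..T}" "y \<ge> 1" for t y
    unfolding F_def
  proof (intro integrable_integral integrable_continuous_real continuous_on_poly continuous_on_divide continuous_on_const)
    show "continuous_on {0..t} (\<lambda>s. h s y)"
      by (rule continuous_on_subset[OF h_continuous]) (use that in auto)
    show "\<forall>s\<in>{0..t}. h s y \<noteq> 0"
      using Im_h_pos[of _ y] that by fastforce
  qed
  \<comment> \<open>The order m of the flow known from the moment 2k rises by two under inversion,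
    which matches the hypothesis exactly.\<close>
  have "expands {0..T} (m + 2) (\<lambda>s y. poly P (1 / h s y))"
    using expands_poly_comp[OF expands_inverse_shift(2)[OF flow compact_Icc] compact_Icc P0(1)] Im by simp
  then have "expands {0..T} (m + 2) F" by (rule expands_integral[OF _ F])
  then have "expands {T} (m + 2) F" by (rule expands_subset) (use T in auto)
  then have "expands {T} (m + 2) (\<lambda>s y. (h T y - \<i> * complex_of_real y) + - F s y)"
    using exp unfolding m(2) by (intro expands_add expands_minus) auto
  then obtain p C where p: "poly_path {T} p" "C \<ge> 0" "\<And>s y. s \<in> {T} \<Longrightarrow> y \<ge> 1 \<Longrightarrow>
      norm (((h T y - \<i> * complex_of_real y) + - F s y) - poly (p s) (iu y)) \<le> C / y ^ (m + 2)"
    by (rule expandsE, blast)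
  \<comment> \<open>\<open>G\<close> is the time integral of the remainder of A along the flow, and
    \<phi> removes its factor \<open>iu y ^ m\<close>. Thus \<phi> should be close to T times
    \<open>K\<close>.\<close>
  define G where "G y = h T y - \<i> * complex_of_real y - F T y" for y
  define \<phi> where "\<phi> y = (\<i> * complex_of_real y) ^ m * G y" for y
  \<comment> \<open>The summand 1 makes \<open>B\<close> positive, so that one may divide by it when
    choosing the parameter of \<open>W.tail_le\<close>.\<close>
  define B where "B = D * (1 + D) + real m * D + 1"
  have B: "B > 0" using D by (simp add: B_def add_nonneg_pos)
  have G: "norm (G y - of_real T * (iu y ^ m * K y)) \<le> (B * (W.tail y / y) + M0 / y\<^sup>2) / y ^ m * T"
    if y: "y \<ge> 1" for y
  proof -
    define R where "R w = (1 / w) ^ m * first_resolvent (weighted k \<tau>) w + (1 / w) ^ Suc m * resolvent (weighted k \<tau>) w" for w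
    have "((\<lambda>s. gen_A \<gamma> \<tau> (h s y) - poly P (1 / h s y)) has_integral G y) {0..T}"
      unfolding G_def using h_integral[of T y] F[of T y] T y by (intro has_integral_diff) auto
    moreover have "gen_A \<gamma> \<tau> (h s y) - poly P (1 / h s y) = R (h s y)" if "s \<in> {0..T}" for s
      using P[of "h s y"] Im[OF that y] y by (simp add: R_def)
    ultimately have "((\<lambda>s. R (h s y)) has_integral G y) {0..T}"
      by (rule has_integral_eq[rotated])
    then have "((\<lambda>s. R (h s y) - iu y ^ m * K y) has_integral G y - of_real T * (iu y ^ m * K y)) {0..T}"
      using has_integral_const_real[of "iu y ^ m * K y" 0 T] T
      by (intro has_integral_diff) (simp_all add: scaleR_conv_of_real)
    then have "norm (G y - of_real T * (iu y ^ m * K y)) \<le> (B * (W.tail y / y) + M0 / y\<^sup>2) / y ^ m * measure lborel {0..T}"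
      unfolding box_real(2)[symmetric]
    proof (rule has_integral_bound[rotated])
      show "0 \<le> (B * (W.tail y / y) + M0 / y\<^sup>2) / y ^ m"
        using B M0 W.tail_bounds(1)[of y] y by simp
      fix s assume "s \<in> cbox 0 T"
      then have s: "s \<in> {0..T}" by simp
      have "norm ((1 / h s y) ^ m * first_resolvent (weighted k \<tau>) (h s y) - iu y ^ m * K y)
        \<le> (D * (1 + D) + real m * D) * (W.tail y / y) / y ^ m"
        unfolding K_def by (rule W.scaled_first_resolvent_perturbation[OF y Im[OF s y] D(2)[OF s y]])
      also have "\<dots> \<le> B * (W.tail y / y) / y ^ m"
        using W.tail_bounds(1)[of y] y by (intro divide_right_mono mult_right_mono) (auto simp: B_def)
      finally have 1: "norm ((1 / h s y) ^ m * first_resolvent (weighted k \<tau>) (h s y) - iu y ^ m * K y) \<le> B * (W.tail y / y) / y ^ m" .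
      have "y \<le> norm (h s y)" using Im[OF s y] abs_Im_le_cmod[of "h s y"] by linarith
      then have "norm (1 / h s y) \<le> 1 / y" using y by (simp add: norm_divide frac_le)
      moreover have "norm (resolvent (weighted k \<tau>) (h s y)) \<le> M0 / y"
        using W.norm_resolvent_le[of "h s y"] Im[OF s y] y M0
        by (intro order_trans[OF W.norm_resolvent_le]) (auto simp: M0_def frac_le)
      ultimately have "norm ((1 / h s y) ^ Suc m * resolvent (weighted k \<tau>) (h s y)) \<le> (1 / y) ^ Suc m * (M0 / y)"
        unfolding norm_mult norm_power using y by (intro mult_mono power_mono) auto
      also have "\<dots> = M0 / y\<^sup>2 / y ^ m" by (simp add: power_divide power2_eq_square)
      finally have 2: "norm ((1 / h s y) ^ Suc m * resolvent (weighted k \<tau>) (h s y)) \<le> M0 / y\<^sup>2 / y ^ m" .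
      have "R (h s y) - iu y ^ m * K y = ((1 / h s y) ^ m * first_resolvent (weighted k \<tau>) (h s y) - iu y ^ m * K y)
        + (1 / h s y) ^ Suc m * resolvent (weighted k \<tau>) (h s y)"
        by (simp add: R_def)
      then show "norm (R (h s y) - iu y ^ m * K y) \<le> (B * (W.tail y / y) + M0 / y\<^sup>2) / y ^ m"
        unfolding add_divide_distrib using norm_triangle_le[OF add_mono[OF 1 2]] by metis
    qed
    then show ?thesis using T by simp
  qed
  have \<phi>: "norm (\<phi> y - of_real T * K y) \<le> (B * (W.tail y / y) + M0 / y\<^sup>2) * T" if y: "y \<ge> 1" for y
  proof -
    have "(\<i> * complex_of_real y) ^ m * iu y ^ m = 1"
      using iu_mult_iy[of y] y by (simp add: power_mult_distrib[symmetric] mult.commute)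
    then have "\<phi> y - of_real T * K y = (\<i> * complex_of_real y) ^ m * (G y - of_real T * (iu y ^ m * K y))"
      by (simp add: \<phi>_def right_diff_distrib mult.left_commute mult.commute)
    then have "norm (\<phi> y - of_real T * K y) = y ^ m * norm (G y - of_real T * (iu y ^ m * K y))"
      using y by (simp add: norm_mult norm_power)
    also have "\<dots> \<le> y ^ m * ((B * (W.tail y / y) + M0 / y\<^sup>2) / y ^ m * T)"
      using y by (intro mult_left_mono G) auto
    finally show ?thesis using y by simp
  qed
  have "\<exists>D'. \<forall>y\<ge>1. \<bar>Re (\<phi> y)\<bar> \<le> D' / y ^ 2"
  proof (rule Re_bound_of_real_poly_approx)
    show "real_poly (p T)" using p(1) by (simp add: poly_path_def)
    have "((\<lambda>y. (\<phi> y - of_real T * K y) + of_real T * K y) \<longlongrightarrow> 0 + of_real T * 0) at_top"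
    proof (intro tendsto_add tendsto_mult tendsto_const)
      show "((\<lambda>y. \<phi> y - of_real T * K y) \<longlongrightarrow> 0) at_top"
      proof (rule tendsto_inverse_power_bound[where K = 1])
        fix y :: real assume y: "y \<ge> 1"
        \<comment> \<open>For the limit the crude bound of \<open>W.tail y\<close> by the total mass
          suffices.\<close>
        have "(B * (W.tail y / y) + M0 / y\<^sup>2) * T \<le> (B * (M0 / y) + M0 / y) * T"
          using B T M0 y W.tail_bounds(2)[of y]
          by (intro mult_right_mono add_mono mult_left_mono divide_right_mono divide_left_mono)
            (auto simp: M0_def power2_eq_square)
        also have "\<dots> = (B * M0 + M0) * T / y ^ 1" by (simp add: algebra_simps add_divide_distrib)
        finally show "norm (\<phi> y - of_real T * K y) \<le> (B * M0 + M0) * T / y ^ 1"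
          using \<phi>[OF y] by linarith
      qed simp
      show "(K \<longlongrightarrow> 0) at_top" unfolding K_def by (rule W.first_resolvent_tendsto_0)
    qed
    then show "(\<phi> \<longlongrightarrow> 0) at_top" by simp
    fix y :: real assume y: "y \<ge> 1"
    have "iu y ^ m * (\<i> * complex_of_real y) ^ m = 1"
      using iu_mult_iy[of y] y by (simp add: power_mult_distrib[symmetric])
    then have "iu y ^ m * \<phi> y = G y" by (simp add: \<phi>_def flip: mult.assoc)
    then show "norm (iu y ^ m * \<phi> y - poly (p T) (iu y)) \<le> C / y ^ (m + 2)"
      using p(3)[of T y] y by (simp add: G_def)
  qed
  then obtain D' where D': "\<And>y. y \<ge> 1 \<Longrightarrow> \<bar>Re (\<phi> y)\<bar> \<le> D' / y ^ 2" by blast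
  define Q where "Q = (D' / T + B\<^sup>2 * M0 / 2 + M0) * 2"
  have "(\<integral>x. x\<^sup>2 / (x\<^sup>2 + y\<^sup>2) \<partial>weighted k \<tau>) \<le> Q / y\<^sup>2" if y: "y \<ge> 1" for y
  proof -
    define r where "r = Re (K y)"
    have r: "r = (\<integral>x. x\<^sup>2 / (x\<^sup>2 + y\<^sup>2) \<partial>weighted k \<tau>)"
      unfolding r_def K_def using y by (intro W.Re_first_resolvent) auto
    have "T * r = Re (\<phi> y) - Re (\<phi> y - of_real T * K y)" by (simp add: r_def)
    also have "\<dots> \<le> D' / y\<^sup>2 + (B * (W.tail y / y) + M0 / y\<^sup>2) * T"
      using D'[OF y] \<phi>[OF y] abs_Re_le_cmod[of "\<phi> y - of_real T * K y"] by linarith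
    finally have "r \<le> (D' / y\<^sup>2 + (B * (W.tail y / y) + M0 / y\<^sup>2) * T) / T"
      using T by (simp add: le_divide_eq mult.commute)
    also have "\<dots> = D' / T / y\<^sup>2 + (B * (W.tail y / y) + M0 / y\<^sup>2)"
      using T by (simp add: add_divide_distrib)
    finally have 1: "r \<le> D' / T / y\<^sup>2 + (B * (W.tail y / y) + M0 / y\<^sup>2)" .
    \<comment> \<open>The parameter 1 / (2 B) turns the tail term into r / 2 plus a term of order
      y^(-2); r / 2 is then moved to the left, which accounts for the factor 2 in
      \<open>Q\<close>.\<close>
    have "B * (W.tail y / y) \<le> B * (1 / (2 * B) * r + M0 / (4 * (1 / (2 * B)) * y\<^sup>2))"
      unfolding r_def K_def M0_def using B y by (intro mult_left_mono W.tail_le) auto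
    also have "\<dots> = r / 2 + B\<^sup>2 * M0 / 2 / y\<^sup>2"
      using B by (simp add: field_simps power2_eq_square)
    finally have "r / 2 \<le> D' / T / y\<^sup>2 + B\<^sup>2 * M0 / 2 / y\<^sup>2 + M0 / y\<^sup>2" using 1 by linarith
    then have "r \<le> (D' / T / y\<^sup>2 + B\<^sup>2 * M0 / 2 / y\<^sup>2 + M0 / y\<^sup>2) * 2"
      by (simp only: divide_le_eq_numeral1)
    also have "\<dots> = Q / y\<^sup>2"
      by (simp only: Q_def add_divide_distrib times_divide_eq_left[symmetric])
    finally show ?thesis using r by simp
  qed
  then show ?thesis
    unfolding tau.nn_integral_weighted[symmetric] by (rule W.second_moment_finite)
qed

text \<open>The moments of \<tau> are gained two orders at a time: positivity of Im A gives order 2,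
  and each later step uses the expansion of h at time T truncated to the order required.\<close>

lemma generator_moment_finite:
  assumes "T > 0" "n \<ge> 1" and fin: "(\<integral>\<^sup>+x. ennreal (x ^ (2 * n)) \<partial>\<mu> T) < \<infinity>"
  shows "(\<integral>\<^sup>+x. ennreal (x ^ (2 * n)) \<partial>\<tau>) < \<infinity>"
proof -
  interpret real_distribution "\<mu> T" using distr assms by simp
  have exp: "expands {T} (2 * n - 1) (\<lambda>s y. h T y - \<i> * complex_of_real y)"
    unfolding h_def by (rule recip_H_expands[OF fin]) (use assms in auto)
  have "k \<le> n \<Longrightarrow> k \<ge> 1 \<Longrightarrow> (\<integral>\<^sup>+x. ennreal (x ^ (2 * k)) \<partial>\<tau>) < \<infinity>" for k
  proof (induction k)
    case (Suc k)
    show ?case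
    proof (cases "k = 0")
      case True
      have "(\<integral>\<^sup>+x. ennreal (x\<^sup>2) \<partial>\<mu> T) < \<infinity>"
      proof -
        have "integrable (\<mu> T) (\<lambda>x. x ^ 2)"
          by (rule integrable_moment[OF fin]) (use assms in simp)
        then show ?thesis
          by (subst nn_integral_eq_integral) auto
      qed
      from generator_second_moment[OF this assms(1)] show ?thesis using True by simp
    next
      case False
      show ?thesis
      proof (rule generator_next_moment[OF assms(1)])
        show "expands {T} (2 * k + 1) (\<lambda>s y. h T y - \<i> * complex_of_real y)"
          by (rule expands_mono[OF exp]) (use Suc.prems in simp)
      qed (use Suc False in auto)
    qed
  qed simp
  then show ?thesis using assms(2) by simp
qed

end

theorem theorem6p8:
  fixes \<mu> :: "real \<Rightarrow> real measure" and \<gamma> :: real and \<tau> :: "real measure" and n :: nat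
  assumes "mono_conv_semigroup \<mu>"
    and "\<mu> 0 = return borel 0"
    and "assoc_pair \<mu> \<gamma> \<tau>"
    and "n \<ge> 1"
  shows "((\<exists>t0>0. (\<integral>\<^sup>+ x. ennreal (x ^ (2 * n)) \<partial>(\<mu> t0)) < \<infinity>)
           \<longleftrightarrow> (\<forall>t>0. (\<integral>\<^sup>+ x. ennreal (x ^ (2 * n)) \<partial>(\<mu> t)) < \<infinity>))
       \<and> ((\<forall>t>0. (\<integral>\<^sup>+ x. ennreal (x ^ (2 * n)) \<partial>(\<mu> t)) < \<infinity>)
           \<longleftrightarrow> (\<integral>\<^sup>+ x. ennreal (x ^ (2 * n)) \<partial>\<tau>) < \<infinity>)"
proof -
  have "monotone_flow \<mu> \<gamma> \<tau>"
    using assms(1,3)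
    by (auto simp: monotone_flow_def mono_conv_semigroup_def is_prob_real_def assoc_pair_def
        real_distribution_def real_distribution_axioms_def finite_borel_measure_def
        finite_borel_measure_axioms_def)
  then interpret monotone_flow \<mu> \<gamma> \<tau> .
  have "(\<integral>\<^sup>+ x. ennreal (x ^ (2 * n)) \<partial>\<tau>) < \<infinity>" if "t > 0" "(\<integral>\<^sup>+ x. ennreal (x ^ (2 * n)) \<partial>\<mu> t) < \<infinity>" for t
    using generator_moment_finite that assms(4) by blast
  moreover have "(\<integral>\<^sup>+ x. ennreal (x ^ (2 * n)) \<partial>\<mu> t) < \<infinity>" if "t > 0" "(\<integral>\<^sup>+ x. ennreal (x ^ (2 * n)) \<partial>\<tau>) < \<infinity>" for t
    using moment_finite_of_generator that assms(4) by blast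
  \<comment> \<open>A moment at one time passes to \<tau> and from there to all times; conversely t
    = 1 serves as \<open>t0\<close>.\<close>
  ultimately show ?thesis by (meson zero_less_one)
qed

end
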